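(* Let $n\ge 1$ and $d\ge 3$, and let $f,g\in\mathbb{C}[x_0,\dots,x_n]$ be two homogeneous polynomials of degree $d$ such that $V(f)\neq V(g)$, i.e. $f\notin\mathbb{C}^*g$. If $J_f=J_g$, then either the hypersurface $V(f)\subset\mathbb{P}^n$ has a singularity of multiplicity $d-1$, or $f$ is of Sebastiani-Thom type.
   Context: Work over $\mathbb{C}$; $S=\mathbb{C}[x_0,\dots,x_n]$ with its standard grading. A homogeneous polynomial of degree $d$ is understood to be nonzero. For a homogeneous polynomial $f\in S$, $J_f$ is the Jacobian ideal, i.e. the homogeneous ideal of $S$ generated by the first order partial derivatives $f_i=\partial f/\partial x_i$, $i=0,\dots,n$. $V(f)\subset\mathbb{P}^n$ is the projective hypersurface $f=0$, taken with its scheme structure (so $V(f)\ne V(g)$ means precisely $f\notin\mathbb{C}^*g$). A point $p\in V(f)$ has multiplicity $m$ if a local equation of $V(f)$ at $p$ lies in $\mathfrak{m}_p^m$ but not in $\mathfrak{m}_p^{m+1}$; it is a singularity if $m\ge 2$. A homogeneous polynomial $f$ of degree $d$ is of Sebastiani-Thom type (ST type) if, for some choice of homogeneous (linear) coordinates $(x_0,\dots,x_n)$ of $\mathbb{P}^n$, some $0\le l\le n-1$, and some forms $g,h$, each either zero or homogeneous of degree $d$, one has $f(x_0,\dots,x_n)=g(x_0,\dots,x_l)+h(x_{l+1},\dots,x_n)$. The case $h=0$ is allowed (then $f$ is called a cone). *)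

theory Defs
  imports
    Complex_Main
    "HOL-Library.Poly_Mapping"
    "HOL-Computational_Algebra.Fraction_Field"
    "HOL-Algebra.Ideal_Product"
    "Jordan_Normal_Form.Matrix"
begin

section \<open>Polynomials\<close>

text \<open>Complex polynomials in the variables \<open>x\<^sub>0, x\<^sub>1, \<dots>\<close>: a monomial is its exponent
  vector, a polynomial its finitely supported family of coefficients.\<close>

type_synonym cpoly = "(nat \<Rightarrow>\<^sub>0 nat) \<Rightarrow>\<^sub>0 complex"

definition Const :: "complex \<Rightarrow> cpoly" where
  "Const c = Poly_Mapping.single 0 c"

definition Var :: "nat \<Rightarrow> cpoly" where
  "Var i = Poly_Mapping.single (Poly_Mapping.single i 1) 1"

definition polys_in :: "nat set \<Rightarrow> cpoly set" where
  "polys_in X = {f. \<forall>m \<in> Poly_Mapping.keys f. Poly_Mapping.keys m \<subseteq> X}"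

definition poly_ring :: "nat \<Rightarrow> cpoly ring" where
  "poly_ring n =
     \<lparr>carrier = polys_in {..n}, monoid.mult = (*), one = 1, zero = 0, add = (+)\<rparr>"

definition mdeg :: "(nat \<Rightarrow>\<^sub>0 nat) \<Rightarrow> nat" where
  "mdeg m = (\<Sum>i \<in> Poly_Mapping.keys m. Poly_Mapping.lookup m i)"

text \<open>Homogeneous polynomials of degree \<open>d\<close> in the variables indexed by \<open>X\<close>; nonzero by
  convention.\<close>

definition form_in :: "nat set \<Rightarrow> nat \<Rightarrow> cpoly \<Rightarrow> bool" where
  "form_in X d f \<longleftrightarrow> f \<noteq> 0 \<and> f \<in> polys_in X \<and> (\<forall>m \<in> Poly_Mapping.keys f. mdeg m = d)"

abbreviation form :: "nat \<Rightarrow> nat \<Rightarrow> cpoly \<Rightarrow> bool" where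
  "form n \<equiv> form_in {..n}"

definition poly_eval :: "(nat \<Rightarrow> complex) \<Rightarrow> cpoly \<Rightarrow> complex" where
  "poly_eval p f = (\<Sum>m \<in> Poly_Mapping.keys f. Poly_Mapping.lookup f m * (\<Prod>i \<in> Poly_Mapping.keys m. p i ^ Poly_Mapping.lookup m i))"

definition subst_poly :: "(nat \<Rightarrow> cpoly) \<Rightarrow> cpoly \<Rightarrow> cpoly" where
  "subst_poly y f = (\<Sum>m \<in> Poly_Mapping.keys f. Const (Poly_Mapping.lookup f m) * (\<Prod>i \<in> Poly_Mapping.keys m. y i ^ Poly_Mapping.lookup m i))"

text \<open>The subtraction of exponents below is truncated, but where the exponent of \<open>x\<^sub>i\<close> is zero
  the coefficient vanishes.\<close>

definition pdiff :: "nat \<Rightarrow> cpoly \<Rightarrow> cpoly" where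
  "pdiff i f = (\<Sum>m \<in> Poly_Mapping.keys f.
     Poly_Mapping.single (m - Poly_Mapping.single i 1) (of_nat (Poly_Mapping.lookup m i) * Poly_Mapping.lookup f m))"

definition jacobian_ideal :: "nat \<Rightarrow> cpoly \<Rightarrow> cpoly set" where
  "jacobian_ideal n f = Idl\<^bsub>poly_ring n\<^esub> ((\<lambda>i. pdiff i f) ` {..n})"


section \<open>Multiplicity of a point of a projective hypersurface\<close>

text \<open>A point of projective \<open>n\<close>-space is given by homogeneous coordinates \<open>p 0, \<dots>, p n\<close>, not all
  zero; the values \<open>p i\<close> with \<open>i > n\<close> are irrelevant.\<close>

definition proj_point :: "nat \<Rightarrow> (nat \<Rightarrow> complex) \<Rightarrow> bool" where
  "proj_point n p \<longleftrightarrow> (\<exists>i \<le> n. p i \<noteq> 0)"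

text \<open>The local ring of projective \<open>n\<close>-space at \<open>p\<close>, as the subring of the field of fractions of
  the polynomials consisting of the quotients \<open>a/b\<close> of forms of the same degree with
  \<open>b(p) \<noteq> 0\<close> (or \<open>a = 0\<close>), and its maximal ideal.\<close>

definition local_ring :: "nat \<Rightarrow> (nat \<Rightarrow> complex) \<Rightarrow> cpoly fract ring" where
  "local_ring n p =
     \<lparr>carrier = {Fraction_Field.Fract a b | a b e.
                   (a = 0 \<or> form n e a) \<and> form n e b \<and> poly_eval p b \<noteq> 0},
      monoid.mult = (*), one = 1, zero = 0, add = (+)\<rparr>"

definition local_max_ideal :: "nat \<Rightarrow> (nat \<Rightarrow> complex) \<Rightarrow> cpoly fract set" where
  "local_max_ideal n p =
     {Fraction_Field.Fract a b | a b e.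
        (a = 0 \<or> form n e a) \<and> form n e b \<and> poly_eval p b \<noteq> 0 \<and> poly_eval p a = 0}"

definition local_max_ideal_power :: "nat \<Rightarrow> (nat \<Rightarrow> complex) \<Rightarrow> nat \<Rightarrow> cpoly fract set" where
  "local_max_ideal_power n p k = local_max_ideal n p [^]\<^bsub>ideals_set (local_ring n p)\<^esub> k"

text \<open>Local equations at \<open>p\<close> of the hypersurface \<open>f = 0\<close> are obtained by dividing \<open>f\<close> by a form of
  the same degree that does not vanish at \<open>p\<close> (for example by a power of a coordinate); two
  of them differ by a unit of the local ring.\<close>

definition local_equation :: "nat \<Rightarrow> cpoly \<Rightarrow> (nat \<Rightarrow> complex) \<Rightarrow> cpoly fract \<Rightarrow> bool" where
  "local_equation n f p \<phi> \<longleftrightarrow>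
     (\<exists>d s. form n d f \<and> form n d s \<and> poly_eval p s \<noteq> 0 \<and> \<phi> = Fraction_Field.Fract f s)"

definition has_multiplicity :: "nat \<Rightarrow> cpoly \<Rightarrow> (nat \<Rightarrow> complex) \<Rightarrow> nat \<Rightarrow> bool" where
  "has_multiplicity n f p m \<longleftrightarrow>
     (\<exists>\<phi>. local_equation n f p \<phi> \<and>
          \<phi> \<in> local_max_ideal_power n p m \<and> \<phi> \<notin> local_max_ideal_power n p (Suc m))"

definition singularity_of_multiplicity :: "nat \<Rightarrow> cpoly \<Rightarrow> (nat \<Rightarrow> complex) \<Rightarrow> nat \<Rightarrow> bool" where
  "singularity_of_multiplicity n f p m \<longleftrightarrow>
     proj_point n p \<and> poly_eval p f = 0 \<and> has_multiplicity n f p m \<and> m \<ge> 2"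


section \<open>Sebastiani-Thom type\<close>

text \<open>The \<open>i\<close>-th new coordinate defined by the matrix \<open>A\<close>.\<close>

definition linear_coord :: "nat \<Rightarrow> complex mat \<Rightarrow> nat \<Rightarrow> cpoly" where
  "linear_coord n A i = (\<Sum>j \<le> n. Const (A $$ (i, j)) * Var j)"

definition ST_type :: "nat \<Rightarrow> nat \<Rightarrow> cpoly \<Rightarrow> bool" where
  "ST_type n d f \<longleftrightarrow> form n d f \<and>
     (\<exists>A l g h. A \<in> carrier_mat (Suc n) (Suc n) \<and> invertible_mat A \<and> l < n \<and>
        (g = 0 \<or> form_in {..l} d g) \<and> (h = 0 \<or> form_in {Suc l..n} d h) \<and>
        f = subst_poly (linear_coord n A) g + subst_poly (linear_coord n A) h)"

end

theory Submission
  imports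
    Defs
    "Jordan_Normal_Form.Jordan_Normal_Form_Existence"
    "HOL-Computational_Algebra.Polynomial_Factorial"
begin

text \<open>Comparing the parts of degree \<open>d - 1\<close> of \<open>J\<^sub>f = J\<^sub>g\<close> gives a constant matrix \<open>A\<close> with
  \<open>grad g = A grad f\<close>, and \<open>A\<close> is not scalar by Euler's formula. Let \<open>q\<^sub>0, \<dots>, q\<^sub>n\<close> be a basis that
  brings \<open>A\<close> into Jordan form and \<open>D\<^sub>i\<close> the derivative along \<open>q\<^sub>i\<close>, so that
  \<open>D\<^sub>i g = a\<^sub>i D\<^sub>i f + \<epsilon>\<^sub>i D\<^sub>i\<^sub>+\<^sub>1 f\<close>. Since \<open>D\<^sub>j D\<^sub>i g\<close> is symmetric in \<open>i, j\<close>,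
  \<open>(a\<^sub>i - a\<^sub>j) D\<^sub>i D\<^sub>j f = \<epsilon>\<^sub>j D\<^sub>i D\<^sub>j\<^sub>+\<^sub>1 f - \<epsilon>\<^sub>i D\<^sub>i\<^sub>+\<^sub>1 D\<^sub>j f\<close>.
  If two eigenvalues differ, then \<open>D\<^sub>i D\<^sub>j f = 0\<close> whenever \<open>a\<^sub>i \<noteq> a\<^sub>j\<close>, and \<open>f\<close> splits. Otherwise
  some Jordan block has size at least 2; if \<open>k\<close> is its last index, then \<open>D\<^sub>k D\<^sub>k f = 0\<close>. Either
  \<open>D\<^sub>k f = 0\<close> and \<open>f\<close> is a cone, or \<open>f\<close> has degree exactly 1 in the coordinate belonging to
  \<open>q\<^sub>k\<close>, which means that the point \<open>q\<^sub>k\<close> has multiplicity \<open>d - 1\<close>.\<close>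

section \<open>Evaluation homomorphisms\<close>

abbreviation expo :: "nat \<Rightarrow> nat \<Rightarrow>\<^sub>0 nat" where
  "expo i \<equiv> Poly_Mapping.single i 1"

definition monom_eval :: "(nat \<Rightarrow> 'a::comm_ring_1) \<Rightarrow> (nat \<Rightarrow>\<^sub>0 nat) \<Rightarrow> 'a" where
  "monom_eval y m = (\<Prod>i \<in> Poly_Mapping.keys m. y i ^ Poly_Mapping.lookup m i)"

text \<open>The common form of \<open>poly_eval\<close>, \<open>subst_poly\<close> and later
  \<open>grading\<close>. Any ring homomorphism \<open>h\<close> on the coefficients makes it a ring
  homomorphism, so this is proved only once.\<close>

definition hom_eval :: "(complex \<Rightarrow> 'a::comm_ring_1) \<Rightarrow> (nat \<Rightarrow> 'a) \<Rightarrow> cpoly \<Rightarrow> 'a" where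
  "hom_eval h y f = (\<Sum>m \<in> Poly_Mapping.keys f. h (Poly_Mapping.lookup f m) * monom_eval y m)"

lemma poly_eval_eq_hom_eval: "poly_eval p = hom_eval id p"
  by (simp add: fun_eq_iff poly_eval_def hom_eval_def monom_eval_def)

lemma subst_poly_eq_hom_eval: "subst_poly = hom_eval Const"
  by (simp add: fun_eq_iff subst_poly_def hom_eval_def monom_eval_def)

lemma monom_eval_superset:
  assumes "finite A" "Poly_Mapping.keys m \<subseteq> A"
  shows "monom_eval y m = (\<Prod>i \<in> A. y i ^ Poly_Mapping.lookup m i)"
  unfolding monom_eval_def
  by (rule prod.mono_neutral_left) (use assms in \<open>auto simp: in_keys_iff\<close>)

lemma monom_eval_add: "monom_eval y (m + m') = monom_eval y m * monom_eval y m'"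
proof -
  let ?A = "Poly_Mapping.keys m \<union> Poly_Mapping.keys m'"
  have "Poly_Mapping.keys (m + m') \<subseteq> ?A"
    by (rule keys_add)
  then show ?thesis
    by (simp add: monom_eval_superset[of ?A] lookup_add power_add prod.distrib)
qed

lemma monom_eval_zero [simp]: "monom_eval y 0 = 1"
  by (simp add: monom_eval_def)

lemma monom_eval_single [simp]: "monom_eval y (Poly_Mapping.single i k) = y i ^ k"
  by (simp add: monom_eval_def)

lemma mdeg_superset:
  assumes "finite A" "Poly_Mapping.keys m \<subseteq> A"
  shows "mdeg m = (\<Sum>i \<in> A. Poly_Mapping.lookup m i)"
  unfolding mdeg_def
  by (rule sum.mono_neutral_left) (use assms in \<open>auto simp: in_keys_iff\<close>)

lemma mdeg_add: "mdeg (m + m') = mdeg m + mdeg m'"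
  unfolding mdeg_def by (rule setsum_keys_plus_distrib) simp_all

lemma mdeg_zero [simp]: "mdeg 0 = 0"
  by (simp add: mdeg_def)

lemma mdeg_single [simp]: "mdeg (Poly_Mapping.single i k) = k"
  by (simp add: mdeg_def)

lemma mdeg_eq_0_iff [simp]: "mdeg m = 0 \<longleftrightarrow> m = 0"
  by (auto simp: mdeg_def in_keys_iff poly_mapping_eq_iff fun_eq_iff)

section \<open>Expansion into monomials and induction over polynomials\<close>

lemma cpoly_expand: "f = (\<Sum>m \<in> Poly_Mapping.keys f. Poly_Mapping.single m (Poly_Mapping.lookup f m))"
  by (rule poly_mapping_eqI) (auto simp: lookup_sum lookup_single when_def in_keys_iff)

text \<open>For statements additive in \<open>f\<close>. The coefficient \<open>c\<close> may be 0,
  which is how the empty sum is covered without a separate case.\<close>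

lemma polys_in_sum_monomials [consumes 1, case_names monomial add]:
  assumes "f \<in> polys_in X"
    and "\<And>m c. Poly_Mapping.keys m \<subseteq> X \<Longrightarrow> P (Poly_Mapping.single m c)"
    and "\<And>f g. P f \<Longrightarrow> P g \<Longrightarrow> P (f + g)"
  shows "P f"
proof -
  have "P (\<Sum>m \<in> A. Poly_Mapping.single m (Poly_Mapping.lookup f m))"
    if "finite A" "A \<subseteq> Poly_Mapping.keys f" for A
    using that
  proof (induction A rule: finite_induct)
    case empty
    have "P (Poly_Mapping.single 0 0)"
      by (rule assms(2)) simp
    then show ?case by simp
  next
    case (insert m A)
    then show ?case
      using assms by (auto simp: polys_in_def)
  qed
  then show ?thesis
    using cpoly_expand[of f] by (metis finite_keys order_refl)
qed

lemma polys_in_UNIV [simp]: "f \<in> polys_in UNIV"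
  by (simp add: polys_in_def)

lemmas cpoly_sum_monomials [case_names monomial add] =
  polys_in_sum_monomials[OF polys_in_UNIV]

lemma Const_0 [simp]: "Const 0 = 0"
  by (simp add: Const_def)

lemma Const_1 [simp]: "Const 1 = 1"
  by (simp add: Const_def)

lemma Const_eq_0_iff [simp]: "Const c = 0 \<longleftrightarrow> c = 0"
  by (metis Const_0 Const_def lookup_single_eq lookup_zero)

lemma Const_add: "Const (a + b) = Const a + Const b"
  by (simp add: Const_def single_add)

lemma Const_mult: "Const (a * b) = Const a * Const b"
  by (simp add: Const_def mult_single)

interpretation Const: comm_ring_hom Const
  by unfold_locales (simp_all add: Const_add Const_mult)

lemma Const_of_nat: "Const (of_nat k) = of_nat k"
  by (rule Const.hom_of_nat)

lemma Const_mult_single: "Const a * Poly_Mapping.single m b = Poly_Mapping.single m (a * b)"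
  by (simp add: Const_def mult_single)

lemma lookup_Const_mult [simp]:
  "Poly_Mapping.lookup (Const a * f) m = a * Poly_Mapping.lookup f m"
  by (induction f rule: cpoly_sum_monomials)
    (simp_all add: Const_mult_single lookup_single when_def distrib_left lookup_add)

lemma monom_eval_Var: "monom_eval Var m = Poly_Mapping.single m 1"
proof -
  have pow: "Var i ^ k = Poly_Mapping.single (Poly_Mapping.single i k) 1" for i k
    by (induction k) (simp_all add: Var_def mult_single single_add[symmetric])
  have "(\<Prod>i \<in> A. Var i ^ Poly_Mapping.lookup m i)
      = Poly_Mapping.single (\<Sum>i \<in> A. Poly_Mapping.single i (Poly_Mapping.lookup m i)) 1"
    if "finite A" for A
    using that by (induction A rule: finite_induct) (simp_all add: pow mult_single)
  moreover have "(\<Sum>i \<in> Poly_Mapping.keys m. Poly_Mapping.single i (Poly_Mapping.lookup m i)) = m"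
    by (rule poly_mapping_eqI) (auto simp: lookup_sum lookup_single when_def in_keys_iff)
  ultimately show ?thesis
    by (simp add: monom_eval_def)
qed

lemma single_eq_Const_mult: "Poly_Mapping.single m c = Const c * monom_eval Var m"
  by (simp add: monom_eval_Var Const_mult_single)

text \<open>Constants and variables generate the polynomials as a ring. This suits statements
  compatible with products, such as the chain rule.\<close>

lemma polys_in_induct [consumes 1, case_names Const Var add mult]:
  assumes "f \<in> polys_in X"
    and "\<And>c. P (Const c)" and "\<And>i. i \<in> X \<Longrightarrow> P (Var i)"
    and "\<And>f g. P f \<Longrightarrow> P g \<Longrightarrow> P (f + g)"
    and mult: "\<And>f g. P f \<Longrightarrow> P g \<Longrightarrow> P (f * g)"
  shows "P f"
  using assms(1)
proof (induction rule: polys_in_sum_monomials)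
  case (monomial m c)
  have one: "P 1"
    using assms(2)[of 1] by simp
  have pow: "P (Var i ^ k)" if "i \<in> X" for i k
    by (induction k) (use that one assms in auto)
  have "P (\<Prod>i \<in> A. Var i ^ Poly_Mapping.lookup m i)" if "finite A" "A \<subseteq> X" for A
    using that by (induction A rule: finite_induct) (auto intro: one pow mult)
  then show ?case
    using monomial mult assms(2) by (simp add: single_eq_Const_mult monom_eval_def)
qed (rule assms(4))

context comm_ring_hom
begin

lemma hom_monom_eval: "hom (monom_eval y m) = monom_eval (\<lambda>i. hom (y i)) m"
  by (simp add: monom_eval_def hom_prod hom_power)

lemma hom_hom_eval: "hom (hom_eval h y f) = hom_eval (\<lambda>c. hom (h c)) (\<lambda>i. hom (y i)) f"
  by (simp add: hom_eval_def hom_sum hom_mult hom_monom_eval)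

end

context
  fixes h :: "complex \<Rightarrow> 'a::comm_ring_1" and y :: "nat \<Rightarrow> 'a"
  assumes h: "comm_ring_hom h"
begin

interpretation comm_ring_hom h by (rule h)

lemma hom_eval_single [simp]: "hom_eval h y (Poly_Mapping.single m c) = h c * monom_eval y m"
  by (simp add: hom_eval_def)

lemma hom_eval_add: "hom_eval h y (f + g) = hom_eval h y f + hom_eval h y g"
  unfolding hom_eval_def
  by (rule setsum_keys_plus_distrib) (simp_all add: hom_add algebra_simps)

lemma hom_eval_mult: "hom_eval h y (f * g) = hom_eval h y f * hom_eval h y g"
proof (induction f rule: cpoly_sum_monomials)
  case (monomial m c)
  show ?case
    by (induction g rule: cpoly_sum_monomials)
      (simp_all add: mult_single hom_mult monom_eval_add algebra_simps hom_eval_add)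
qed (simp add: algebra_simps hom_eval_add)

lemma hom_eval_Const [simp]: "hom_eval h y (Const c) = h c"
  by (simp add: Const_def)

lemma hom_eval_Var [simp]: "hom_eval h y (Var i) = y i"
  by (simp add: Var_def)

lemma comm_ring_hom_hom_eval: "comm_ring_hom (hom_eval h y)"
  by unfold_locales
    (simp_all add: hom_eval_add hom_eval_mult hom_eval_Const[of 1, simplified]
       hom_eval_Const[of 0, simplified])

end

lemma hom_eval_cong:
  assumes "f \<in> polys_in X" "\<And>c. h c = h' c" "\<And>i. i \<in> X \<Longrightarrow> y i = y' i"
  shows "hom_eval h y f = hom_eval h' y' f"
  unfolding hom_eval_def monom_eval_def
  using assms
  by (intro sum.cong prod.cong arg_cong2[of _ _ _ _ "(*)"])
    (auto simp: polys_in_def intro!: arg_cong[of _ _ "\<lambda>x. x ^ _"])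

lemma hom_subst_poly:
  assumes "comm_ring_hom \<phi>"
  shows "\<phi> (subst_poly y f) = hom_eval (\<lambda>c. \<phi> (Const c)) (\<lambda>i. \<phi> (y i)) f"
  by (simp add: subst_poly_eq_hom_eval comm_ring_hom.hom_hom_eval[OF assms])

lemma subst_poly_Var [simp]: "subst_poly Var f = f"
  by (induction f rule: cpoly_sum_monomials)
    (simp_all add: subst_poly_eq_hom_eval hom_eval_add Const.comm_ring_hom_axioms
      single_eq_Const_mult[symmetric])

interpretation subst_poly: comm_ring_hom "subst_poly y" for y
  unfolding subst_poly_eq_hom_eval by (rule comm_ring_hom_hom_eval) (rule Const.comm_ring_hom_axioms)

interpretation poly_eval: comm_ring_hom "poly_eval p" for p
  unfolding poly_eval_eq_hom_eval by (rule comm_ring_hom_hom_eval) (unfold_locales, simp_all)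

lemma poly_eval_Const [simp]: "poly_eval p (Const c) = c"
  unfolding poly_eval_eq_hom_eval by (subst hom_eval_Const) (unfold_locales, simp_all)

lemma poly_eval_Var [simp]: "poly_eval p (Var i) = p i"
  unfolding poly_eval_eq_hom_eval by (subst hom_eval_Var) (unfold_locales, simp_all)

lemma subst_poly_Const [simp]: "subst_poly y (Const c) = Const c"
  by (simp add: subst_poly_eq_hom_eval Const.comm_ring_hom_axioms)

lemma subst_poly_Var_eq [simp]: "subst_poly y (Var i) = y i"
  by (simp add: subst_poly_eq_hom_eval Const.comm_ring_hom_axioms)

section \<open>Partial derivatives\<close>

text \<open>Reading off coefficients gets rid of the truncated subtraction: a monomial in which
  \<open>Var i\<close> does not occur contributes 0 and is never of the form
  \<open>m + expo i\<close>.\<close>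

lemma lookup_pdiff:
  "Poly_Mapping.lookup (pdiff i f) m
     = of_nat (Suc (Poly_Mapping.lookup m i)) * Poly_Mapping.lookup f (m + expo i)"
proof -
  have single: "(Poly_Mapping.lookup (Poly_Mapping.single (k - expo i)
            (of_nat (Poly_Mapping.lookup k i) * c)) m :: complex)
      = (if k = m + expo i then of_nat (Suc (Poly_Mapping.lookup m i)) * c else 0)" for k c
  proof (cases "Poly_Mapping.lookup k i = 0")
    case True
    moreover from this have "k \<noteq> m + expo i"
      by (auto simp: lookup_add)
    ultimately show ?thesis
      by simp
  next
    case False
    then have "k - expo i + expo i = k"
      by (intro poly_mapping_eqI) (auto simp: lookup_add lookup_minus lookup_single when_def)
    then have "k - expo i = m \<longleftrightarrow> k = m + expo i"
      by auto
    then show ?thesis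
      by (auto simp: lookup_single when_def lookup_add)
  qed
  then show ?thesis
    unfolding pdiff_def lookup_sum single by (simp add: in_keys_iff)
qed

lemma pdiff_add: "pdiff i (f + g) = pdiff i f + pdiff i g"
  by (rule poly_mapping_eqI) (simp add: lookup_pdiff lookup_add algebra_simps)

lemma pdiff_Const_mult: "pdiff i (Const c * f) = Const c * pdiff i f"
  by (rule poly_mapping_eqI) (simp add: lookup_pdiff mult.left_commute)

lemma pdiff_0 [simp]: "pdiff i 0 = 0"
  by (simp add: pdiff_def)

lemma pdiff_sum: "pdiff i (sum F A) = (\<Sum>a \<in> A. pdiff i (F a))"
  by (induction A rule: infinite_finite_induct) (simp_all add: pdiff_add)

lemma pdiff_commute: "pdiff i (pdiff j f) = pdiff j (pdiff i f)"
  by (rule poly_mapping_eqI) (simp add: lookup_pdiff lookup_add lookup_single when_def add_ac)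

lemma pdiff_single:
  "pdiff i (Poly_Mapping.single m c)
     = Poly_Mapping.single (m - expo i) (of_nat (Poly_Mapping.lookup m i) * c)"
  by (simp add: pdiff_def)

lemma pdiff_Const [simp]: "pdiff i (Const c) = 0"
  by (simp add: Const_def pdiff_single)

lemma pdiff_Var: "pdiff i (Var j) = (if i = j then 1 else 0)"
  by (simp add: Var_def pdiff_single lookup_single when_def)

text \<open>One half of the Leibniz rule on monomials. If \<open>Var i\<close> does not occur in
  \<open>m\<close>, the truncated exponents may disagree, but both coefficients are 0.\<close>

lemma single_pdiff_mult:
  "Poly_Mapping.single (m - expo i) (of_nat (Poly_Mapping.lookup m i) * c) * Poly_Mapping.single m' c'
    = Poly_Mapping.single (m + m' - expo i) (of_nat (Poly_Mapping.lookup m i) * (c * c') :: complex)"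
proof (cases "Poly_Mapping.lookup m i = 0")
  case False
  then have "m - expo i + m' = m + m' - expo i"
    by (intro poly_mapping_eqI) (auto simp: lookup_add lookup_minus lookup_single when_def)
  then show ?thesis
    by (simp add: mult_single algebra_simps)
qed simp

lemma pdiff_mult: "pdiff i (f * g) = pdiff i f * g + f * pdiff i g"
proof (induction f rule: cpoly_sum_monomials)
  case (monomial m c)
  show ?case
  proof (induction g rule: cpoly_sum_monomials)
    case (monomial m' c')
    show ?case
      using single_pdiff_mult[of m i c m' c'] single_pdiff_mult[of m' i c' m c]
      by (simp add: pdiff_single mult_single lookup_add single_add[symmetric] algebra_simps)
  qed (simp add: pdiff_add algebra_simps)
qed (simp add: pdiff_add algebra_simps)

text \<open>The chain rule. As functions of \<open>f\<close> both sides are additive and obey the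
  same product rule, so constants and variables decide.\<close>

lemma pdiff_subst_poly:
  assumes "f \<in> polys_in {..n}"
  shows "pdiff i (subst_poly y f) = (\<Sum>j\<le>n. subst_poly y (pdiff j f) * pdiff i (y j))"
  using assms
proof (induction rule: polys_in_induct)
  case (Const c)
  then show ?case by simp
next
  case (Var k)
  then show ?case by (simp add: pdiff_Var if_distrib if_distribR cong: if_cong)
next
  case (add f g)
  then show ?case
    by (simp add: subst_poly.hom_add pdiff_add distrib_right sum.distrib)
next
  case (mult f g)
  then show ?case
    unfolding subst_poly.hom_mult pdiff_mult mult subst_poly.hom_add
      sum_distrib_left sum_distrib_right sum.distrib[symmetric]
    by (intro sum.cong) (simp_all add: algebra_simps)
qed

text \<open>The operator on the left multiplies a monomial by the sum of its exponents, which is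
  \<open>d\<close>.\<close>

lemma Euler_formula:
  assumes "form n d f"
  shows "(\<Sum>i\<le>n. Var i * pdiff i f) = of_nat d * f"
proof -
  have "(\<Sum>i\<le>n. Var i * pdiff i f) = of_nat d * f"
    if "f \<in> polys_in {..n}" "\<forall>m \<in> Poly_Mapping.keys f. mdeg m = d" for f
  proof -
    have single: "Var i * pdiff i (Poly_Mapping.single m c)
       = Const (of_nat (Poly_Mapping.lookup m i)) * Poly_Mapping.single m c" for i m c
    proof (cases "Poly_Mapping.lookup m i = 0")
      case False
      then have "expo i + (m - expo i) = m"
        by (intro poly_mapping_eqI) (auto simp: lookup_add lookup_minus lookup_single when_def)
      then show ?thesis
        by (simp add: pdiff_single Var_def mult_single Const_mult_single)
    qed (simp add: pdiff_single)
    have "(\<Sum>i\<le>n. Var i * pdiff i f)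
        = (\<Sum>i\<le>n. \<Sum>m\<in>Poly_Mapping.keys f. Var i * pdiff i (Poly_Mapping.single m (Poly_Mapping.lookup f m)))"
      by (subst cpoly_expand[of f]) (simp add: pdiff_sum sum_distrib_left)
    also have "\<dots> = (\<Sum>m\<in>Poly_Mapping.keys f. \<Sum>i\<le>n.
        Const (of_nat (Poly_Mapping.lookup m i)) * Poly_Mapping.single m (Poly_Mapping.lookup f m))"
      by (subst sum.swap) (simp add: single)
    also have "\<dots> = (\<Sum>m\<in>Poly_Mapping.keys f. of_nat d * Poly_Mapping.single m (Poly_Mapping.lookup f m))"
    proof (rule sum.cong)
      fix m assume m: "m \<in> Poly_Mapping.keys f"
      then have "(\<Sum>i\<le>n. Poly_Mapping.lookup m i) = d"
        using that by (subst mdeg_superset[symmetric]) (auto simp: polys_in_def)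
      then show "(\<Sum>i\<le>n. Const (of_nat (Poly_Mapping.lookup m i)) * Poly_Mapping.single m (Poly_Mapping.lookup f m))
          = of_nat d * Poly_Mapping.single m (Poly_Mapping.lookup f m)"
        by (simp add: Const_of_nat sum_distrib_right[symmetric] of_nat_sum[symmetric] del: of_nat_sum)
    qed simp
    also have "\<dots> = of_nat d * f"
      by (subst (3) cpoly_expand[of f]) (simp add: sum_distrib_left)
    finally show ?thesis .
  qed
  then show ?thesis
    using assms by (simp add: form_in_def)
qed

section \<open>Closure properties of polynomials in given variables and of homogeneous
  polynomials\<close>

lemma polys_in_add: "f \<in> polys_in X \<Longrightarrow> g \<in> polys_in X \<Longrightarrow> f + g \<in> polys_in X"
  using keys_add[of f g] by (auto simp: polys_in_def)

lemma polys_in_mult: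
  assumes "f \<in> polys_in X" "g \<in> polys_in X"
  shows "f * g \<in> polys_in X"
  unfolding polys_in_def
proof (intro CollectI ballI)
  fix m assume "m \<in> Poly_Mapping.keys (f * g)"
  then obtain a b where "m = a + b" "a \<in> Poly_Mapping.keys f" "b \<in> Poly_Mapping.keys g"
    using keys_mult[of f g] by auto
  then show "Poly_Mapping.keys m \<subseteq> X"
    using assms keys_add[of a b] by (fastforce simp: polys_in_def)
qed

lemma polys_in_Const [simp]: "Const c \<in> polys_in X"
  by (auto simp: Const_def polys_in_def)

lemma polys_in_0 [simp]: "0 \<in> polys_in X"
  by (simp add: polys_in_def)

lemma polys_in_1 [simp]: "1 \<in> polys_in X"
  by (simp add: polys_in_def)

lemma polys_in_Var [simp]: "Var i \<in> polys_in X \<longleftrightarrow> i \<in> X"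
  by (auto simp: Var_def polys_in_def)

lemma polys_in_uminus: "f \<in> polys_in X \<Longrightarrow> - f \<in> polys_in X"
  using keys_minus by (simp add: polys_in_def in_keys_iff)

lemma polys_in_sum: "(\<And>a. a \<in> A \<Longrightarrow> F a \<in> polys_in X) \<Longrightarrow> sum F A \<in> polys_in X"
  by (induction A rule: infinite_finite_induct) (auto intro: polys_in_add)

lemma polys_in_pdiff:
  assumes "f \<in> polys_in X"
  shows "pdiff i f \<in> polys_in X"
  unfolding polys_in_def
proof (intro CollectI ballI subsetI)
  fix m j assume "m \<in> Poly_Mapping.keys (pdiff i f)" "j \<in> Poly_Mapping.keys m"
  then have "m + expo i \<in> Poly_Mapping.keys f" "j \<in> Poly_Mapping.keys (m + expo i)"
    by (auto simp: in_keys_iff lookup_pdiff lookup_add)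
  then show "j \<in> X"
    using assms by (auto simp: polys_in_def)
qed

lemma polys_in_subst_poly:
  assumes "f \<in> polys_in X" "\<And>i. i \<in> X \<Longrightarrow> y i \<in> polys_in Z"
  shows "subst_poly y f \<in> polys_in Z"
  using assms(1)
proof (induction rule: polys_in_induct)
qed (auto simp: subst_poly.hom_add subst_poly.hom_mult assms intro: polys_in_add polys_in_mult)

text \<open>Unlike in \<open>form_in\<close>, zero is homogeneous of every degree, so that sums and
  derivatives stay homogeneous.\<close>

definition homog :: "nat \<Rightarrow> cpoly \<Rightarrow> bool" where
  "homog d f \<longleftrightarrow> (\<forall>m \<in> Poly_Mapping.keys f. mdeg m = d)"

lemma form_in_iff: "form_in X d f \<longleftrightarrow> f \<noteq> 0 \<and> f \<in> polys_in X \<and> homog d f"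
  by (simp add: form_in_def homog_def)

lemma homog_0 [simp]: "homog d 0"
  by (simp add: homog_def)

lemma homog_add: "homog d f \<Longrightarrow> homog d g \<Longrightarrow> homog d (f + g)"
  using keys_add[of f g] by (auto simp: homog_def)

lemma homog_sum: "(\<And>a. a \<in> A \<Longrightarrow> homog d (F a)) \<Longrightarrow> homog d (sum F A)"
  by (induction A rule: infinite_finite_induct) (auto intro: homog_add)

lemma homog_mult: "homog d f \<Longrightarrow> homog e g \<Longrightarrow> homog (d + e) (f * g)"
  using keys_mult[of f g] by (fastforce simp: homog_def mdeg_add)

lemma homog_Const: "homog 0 (Const c)"
  by (simp add: homog_def Const_def)

lemma homog_Const_mult: "homog d f \<Longrightarrow> homog d (Const c * f)"
  using homog_mult[OF homog_Const] by fastforce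

lemma homog_Var: "homog 1 (Var i)"
  by (simp add: homog_def Var_def)

lemma homog_power: "homog d f \<Longrightarrow> homog (k * d) (f ^ k)"
proof (induction k)
  case 0
  then show ?case using homog_Const[of 1] by simp
next
  case (Suc k)
  then show ?case using homog_mult[of d f] by simp
qed

lemma homog_pdiff:
  assumes "homog d f"
  shows "homog (d - 1) (pdiff i f)"
  unfolding homog_def
proof
  fix m assume "m \<in> Poly_Mapping.keys (pdiff i f)"
  then have "m + expo i \<in> Poly_Mapping.keys f"
    by (auto simp: in_keys_iff lookup_pdiff)
  then have "mdeg (m + expo i) = d"
    using assms by (simp add: homog_def)
  then show "mdeg m = d - 1"
    by (simp add: mdeg_add)
qed

lemma homog_prod:
  "(\<And>a. a \<in> A \<Longrightarrow> homog (e a) (F a)) \<Longrightarrow> homog (sum e A) (prod F A)"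
  by (induction A rule: infinite_finite_induct)
    (use homog_Const[of 1] in \<open>auto intro: homog_mult\<close>)

lemma homog_monom_eval:
  assumes "\<And>i. i \<in> Poly_Mapping.keys m \<Longrightarrow> homog 1 (y i)"
  shows "homog (mdeg m) (monom_eval y m)"
  unfolding monom_eval_def mdeg_def
  using assms homog_power[of 1] by (intro homog_prod) simp

lemma homog_subst_poly:
  assumes "homog d f" "f \<in> polys_in X" "\<And>i. i \<in> X \<Longrightarrow> homog 1 (y i)"
  shows "homog d (subst_poly y f)"
  unfolding subst_poly_eq_hom_eval hom_eval_def
proof (rule homog_sum)
  fix m assume "m \<in> Poly_Mapping.keys f"
  then have "mdeg m = d" "Poly_Mapping.keys m \<subseteq> X"
    using assms(1,2) by (auto simp: homog_def polys_in_def)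
  moreover from this have "homog (mdeg m) (monom_eval y m)"
    using assms(3) by (intro homog_monom_eval) auto
  ultimately show "homog d (Const (Poly_Mapping.lookup f m) * monom_eval y m)"
    by (auto intro: homog_Const_mult)
qed

section \<open>Linear changes of coordinates\<close>

definition dir_diff :: "nat \<Rightarrow> (nat \<Rightarrow> complex) \<Rightarrow> cpoly \<Rightarrow> cpoly" where
  "dir_diff n v f = (\<Sum>j\<le>n. Const (v j) * pdiff j f)"

lemma dir_diff_commute: "dir_diff n v (dir_diff n w f) = dir_diff n w (dir_diff n v f)"
  unfolding dir_diff_def pdiff_sum pdiff_Const_mult sum_distrib_left
  by (subst sum.swap) (simp add: pdiff_commute mult.left_commute)

lemma dir_diff_add: "dir_diff n v (f + g) = dir_diff n v f + dir_diff n v g"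
  by (simp add: dir_diff_def pdiff_add distrib_left sum.distrib)

lemma dir_diff_Const_mult: "dir_diff n v (Const c * f) = Const c * dir_diff n v f"
  by (simp add: dir_diff_def pdiff_Const_mult sum_distrib_left mult.left_commute)

lemma dir_diff_0 [simp]: "dir_diff n v 0 = 0"
  by (simp add: dir_diff_def)

text \<open>The rows \<open>Q 0, \<dots>, Q n\<close> form a basis of \<open>\<complex>\<^sup>n\<^sup>+\<^sup>1\<close> and the columns of \<open>P\<close> are the dual
  basis; \<open>new_coord i\<close> is the coordinate with respect to \<open>Q i\<close>.\<close>

locale linear_change =
  fixes n :: nat and Q P :: "nat \<Rightarrow> nat \<Rightarrow> complex"
  assumes QP: "i \<le> n \<Longrightarrow> k \<le> n \<Longrightarrow> (\<Sum>j\<le>n. Q i j * P j k) = (if i = k then 1 else 0)"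
    and PQ: "i \<le> n \<Longrightarrow> k \<le> n \<Longrightarrow> (\<Sum>j\<le>n. P i j * Q j k) = (if i = k then 1 else 0)"
begin

text \<open>The variable \<open>Var j\<close> written in the new coordinates. Thus
  \<open>subst_poly old_coord f\<close> is \<open>f\<close> expressed in the coordinates of the
  basis \<open>Q\<close>, and substituting \<open>new_coord\<close> goes back.\<close>

definition old_coord :: "nat \<Rightarrow> cpoly" where
  "old_coord j = (\<Sum>i\<le>n. Const (Q i j) * Var i)"

definition new_coord :: "nat \<Rightarrow> cpoly" where
  "new_coord i = (\<Sum>j\<le>n. Const (P j i) * Var j)"

lemma new_old_coord:
  assumes "j \<le> n"
  shows "subst_poly new_coord (old_coord j) = Var j"
proof -
  have "subst_poly new_coord (old_coord j) = (\<Sum>i\<le>n. \<Sum>k\<le>n. Const (P k i * Q i j) * Var k)"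
    by (simp add: old_coord_def new_coord_def subst_poly.hom_sum subst_poly.hom_mult
        sum_distrib_left Const_mult mult_ac)
  also have "\<dots> = (\<Sum>k\<le>n. Const (\<Sum>i\<le>n. P k i * Q i j) * Var k)"
    by (subst sum.swap) (simp add: Const.hom_sum sum_distrib_right)
  also have "\<dots> = (\<Sum>k\<le>n. if k = j then Var k else 0)"
    using assms by (intro sum.cong) (simp_all add: PQ)
  also have "\<dots> = Var j"
    using assms by simp
  finally show ?thesis .
qed

lemma subst_new_old:
  assumes "f \<in> polys_in {..n}"
  shows "subst_poly new_coord (subst_poly old_coord f) = f"
proof -
  have "subst_poly new_coord (subst_poly old_coord f)
      = hom_eval Const (\<lambda>j. subst_poly new_coord (old_coord j)) f"
    using hom_subst_poly[OF subst_poly.comm_ring_hom_axioms] by simp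
  also have "\<dots> = hom_eval Const Var f"
    using assms by (rule hom_eval_cong) (simp_all add: new_old_coord)
  finally show ?thesis
    by (simp add: subst_poly_eq_hom_eval[symmetric])
qed

text \<open>By the chain rule, since the \<open>i\<close>-th partial derivative of
  \<open>old_coord j\<close> is the constant \<open>Q i j\<close>.\<close>

lemma pdiff_subst_old:
  assumes "f \<in> polys_in {..n}" "i \<le> n"
  shows "pdiff i (subst_poly old_coord f) = subst_poly old_coord (dir_diff n (Q i) f)"
proof -
  have "pdiff i (old_coord j) = Const (Q i j)" for j
    using assms(2)
    by (simp add: old_coord_def pdiff_sum pdiff_Const_mult pdiff_Var if_distrib cong: if_cong)
  then show ?thesis
    using assms(1)
    by (simp add: pdiff_subst_poly dir_diff_def subst_poly.hom_sum subst_poly.hom_mult mult.commute)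
qed

lemma polys_in_dir_diff: "f \<in> polys_in {..n} \<Longrightarrow> dir_diff n v f \<in> polys_in {..n}"
  unfolding dir_diff_def by (intro polys_in_sum polys_in_mult polys_in_pdiff) simp_all

lemma polys_in_subst_old: "f \<in> polys_in {..n} \<Longrightarrow> subst_poly old_coord f \<in> polys_in {..n}"
  by (erule polys_in_subst_poly)
    (auto simp: old_coord_def intro!: polys_in_sum polys_in_mult)

lemma homog_old_coord: "homog 1 (old_coord j)"
  unfolding old_coord_def by (intro homog_sum homog_Const_mult homog_Var)

lemma homog_new_coord: "homog 1 (new_coord j)"
  unfolding new_coord_def by (intro homog_sum homog_Const_mult homog_Var)

text \<open>Translates a vanishing second derivative into missing monomials. In characteristic 0 the
  factors produced by differentiation do not vanish.\<close>

lemma lookup_subst_old_eq_0: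
  assumes f: "f \<in> polys_in {..n}" and "i \<le> n" "j \<le> n"
    and "dir_diff n (Q j) (dir_diff n (Q i) f) = 0"
  shows "Poly_Mapping.lookup (subst_poly old_coord f) (m + expo j + expo i) = 0"
proof -
  have "pdiff j (pdiff i (subst_poly old_coord f)) = 0"
    using assms by (simp add: pdiff_subst_old polys_in_dir_diff)
  then have "Poly_Mapping.lookup (pdiff j (pdiff i (subst_poly old_coord f))) m = 0"
    by simp
  then show ?thesis
    unfolding lookup_pdiff mult_eq_0_iff of_nat_eq_0_iff by simp
qed

text \<open>In the new coordinates no monomial mixes a variable of index at most \<open>l\<close>
  with one of larger index. The monomials therefore fall into two groups, which are summed to
  \<open>g\<close> and \<open>h\<close>.\<close>

lemma ST_type_if_initial_segment:
  assumes f: "form n d f" and l: "l < n"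
    and mixed: "\<And>i j. i \<le> l \<Longrightarrow> l < j \<Longrightarrow> j \<le> n \<Longrightarrow> dir_diff n (Q j) (dir_diff n (Q i) f) = 0"
  shows "ST_type n d f"
proof -
  let ?f = "subst_poly old_coord f"
  let ?mono = "\<lambda>m. Poly_Mapping.single m (Poly_Mapping.lookup ?f m)"
  define G where "G = {m \<in> Poly_Mapping.keys ?f. Poly_Mapping.keys m \<subseteq> {..l}}"
  define g where "g = sum ?mono G"
  define h where "h = sum ?mono (Poly_Mapping.keys ?f - G)"
  have f_in: "f \<in> polys_in {..n}" and f_homog: "homog d f"
    using f by (simp_all add: form_in_iff)
  have sf_in: "?f \<in> polys_in {..n}"
    using f_in by (rule polys_in_subst_old)
  have sf_homog: "homog d ?f"
    using f_homog f_in homog_old_coord by (rule homog_subst_poly)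
  have gh: "?f = g + h"
  proof -
    have "?f = sum ?mono (Poly_Mapping.keys ?f)"
      by (rule cpoly_expand)
    also have "\<dots> = h + g"
      unfolding g_def h_def by (rule sum.subset_diff) (auto simp: G_def)
    finally show ?thesis by (simp add: add.commute)
  qed
  have keys_h: "Poly_Mapping.keys m \<subseteq> {Suc l..n}" if mG: "m \<in> Poly_Mapping.keys ?f - G" for m
  proof
    fix j assume j: "j \<in> Poly_Mapping.keys m"
    obtain i where i: "i \<in> Poly_Mapping.keys m" "\<not> i \<le> l"
      using mG by (auto simp: G_def)
    have le: "i \<le> n" "j \<le> n"
      using mG i j sf_in by (auto simp: polys_in_def)
    show "j \<in> {Suc l..n}"
    proof (rule ccontr)
      assume "j \<notin> {Suc l..n}"
      then have jl: "j \<le> l" using le by simp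
      \<comment> \<open>Both variables occur in \<open>m\<close> and \<open>j \<le> l < i\<close>
        makes them different, so the truncated subtractions lose nothing.\<close>
      then have "m - expo i - expo j + expo i + expo j = m"
        using i j by (intro poly_mapping_eqI)
          (auto simp: lookup_add lookup_minus lookup_single when_def in_keys_iff)
      then have "Poly_Mapping.lookup ?f m = 0"
        using lookup_subst_old_eq_0[OF f_in le(2,1) mixed, of "m - expo i - expo j"] jl i le
        by (simp add: not_le)
      then show False
        using mG by (simp add: in_keys_iff)
    qed
  qed
  have keys_mono: "Poly_Mapping.keys (sum ?mono A) \<subseteq> A" for A
    using keys_sum[of ?mono A] by (auto split: if_splits)
  have g_form: "g = 0 \<or> form_in {..l} d g"
    using keys_mono[of G] sf_homog unfolding g_def form_in_iff polys_in_def homog_def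
    by (force simp: G_def)
  have h_form: "h = 0 \<or> form_in {Suc l..n} d h"
    using keys_mono[of "Poly_Mapping.keys ?f - G"] sf_homog keys_h
    unfolding h_def form_in_iff polys_in_def homog_def by blast
  \<comment> \<open>\<open>linear_coord\<close> takes its coefficients from a row,
    \<open>new_coord\<close> from a column of \<open>P\<close>; hence the transposes.\<close>
  define A where "A = mat (Suc n) (Suc n) (\<lambda>(i, j). P j i)"
  define B where "B = mat (Suc n) (Suc n) (\<lambda>(i, j). Q j i)"
  have "A * B = 1\<^sub>m (Suc n)"
  proof (rule eq_matI)
    fix i j assume "i < dim_row (1\<^sub>m (Suc n) :: complex mat)" "j < dim_col (1\<^sub>m (Suc n) :: complex mat)"
    then have ij: "i \<le> n" "j \<le> n"
      by simp_all
    then have "(A * B) $$ (i, j) = (\<Sum>k\<le>n. Q j k * P k i)"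
      by (simp add: A_def B_def scalar_prod_def atLeast0LessThan lessThan_Suc_atMost less_Suc_eq_le
          mult.commute)
    then show "(A * B) $$ (i, j) = 1\<^sub>m (Suc n) $$ (i, j)"
      using ij by (auto simp: QP)
  qed (simp_all add: A_def B_def)
  moreover have "B * A = 1\<^sub>m (Suc n)"
  proof (rule eq_matI)
    fix i j assume "i < dim_row (1\<^sub>m (Suc n) :: complex mat)" "j < dim_col (1\<^sub>m (Suc n) :: complex mat)"
    then have ij: "i \<le> n" "j \<le> n"
      by simp_all
    then have "(B * A) $$ (i, j) = (\<Sum>k\<le>n. P j k * Q k i)"
      by (simp add: A_def B_def scalar_prod_def atLeast0LessThan lessThan_Suc_atMost less_Suc_eq_le
          mult.commute)
    then show "(B * A) $$ (i, j) = 1\<^sub>m (Suc n) $$ (i, j)"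
      using ij by (auto simp: PQ)
  qed (simp_all add: A_def B_def)
  ultimately have A_inv: "invertible_mat A"
    unfolding invertible_mat_def inverts_mat_def square_mat.simps
    by (auto simp: A_def B_def intro!: exI[of _ B])
  have coord: "linear_coord n A i = new_coord i" if "i \<le> n" for i
    using that unfolding linear_coord_def new_coord_def A_def by (intro sum.cong) simp_all
  have "subst_poly (linear_coord n A) p = subst_poly new_coord p" if "p \<in> polys_in {..n}" for p
    unfolding subst_poly_eq_hom_eval using that by (rule hom_eval_cong) (simp_all add: coord)
  moreover have "g \<in> polys_in {..n}" "h \<in> polys_in {..n}"
    using g_form h_form l by (force simp: form_in_iff polys_in_def)+
  ultimately have "f = subst_poly (linear_coord n A) g + subst_poly (linear_coord n A) h"
    using subst_new_old[OF f_in] by (simp add: gh subst_poly.hom_add)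
  moreover have "A \<in> carrier_mat (Suc n) (Suc n)"
    by (simp add: A_def)
  ultimately show ?thesis
    unfolding ST_type_def using f A_inv l g_form h_form by blast
qed

lemma linear_change_permute:
  assumes "bij_betw \<pi> {..n} {..n}"
  shows "linear_change n (\<lambda>i. Q (\<pi> i)) (\<lambda>j i. P j (\<pi> i))"
proof
  fix i k assume ik: "i \<le> n" "k \<le> n"
  have "\<pi> i \<le> n" "\<pi> k \<le> n" "\<pi> i = \<pi> k \<longleftrightarrow> i = k"
    using assms ik by (auto simp: bij_betw_def inj_on_def)
  then show "(\<Sum>j\<le>n. Q (\<pi> i) j * P j (\<pi> k)) = (if i = k then 1 else 0)"
    by (simp add: QP)
  show "(\<Sum>j\<le>n. P i (\<pi> j) * Q (\<pi> j) k) = (if i = k then 1 else 0)"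
    using sum.reindex_bij_betw[OF assms, of "\<lambda>j. P i j * Q j k"] PQ[OF ik] by simp
qed

text \<open>Permuting the basis moves \<open>S\<close> to the front, where the previous criterion
  applies with \<open>card S = Suc l\<close>. That \<open>S\<close> is nonempty provides
  \<open>l\<close>; that it is proper gives \<open>l < n\<close>.\<close>

lemma ST_type_if_split:
  assumes f: "form n d f" and S: "S \<subseteq> {..n}" "S \<noteq> {}" "S \<noteq> {..n}"
    and mixed: "\<And>i j. i \<in> S \<Longrightarrow> j \<in> {..n} - S \<Longrightarrow> dir_diff n (Q j) (dir_diff n (Q i) f) = 0"
  shows "ST_type n d f"
proof -
  have fin: "finite S"
    using S finite_subset by blast
  obtain l where l: "card S = Suc l"
    using S fin by (metis card_eq_0_iff not0_implies_Suc)
  have "card S < card {..n}"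
    using S by (intro psubset_card_mono) auto
  then have ln: "l < n"
    using l by simp
  obtain \<pi>1 where p1: "bij_betw \<pi>1 {..l} S"
    using finite_same_card_bij[of "{..l}" S] fin l by auto
  have "card {Suc l..n} = card ({..n} - S)"
    using S fin l by (simp add: card_Diff_subset)
  then obtain \<pi>2 where p2: "bij_betw \<pi>2 {Suc l..n} ({..n} - S)"
    using finite_same_card_bij[of "{Suc l..n}" "{..n} - S"] by auto
  define \<pi> where "\<pi> i = (if i \<le> l then \<pi>1 i else \<pi>2 i)" for i
  have q1: "bij_betw \<pi> {..l} S"
    using p1 by (rule bij_betw_cong[THEN iffD1, rotated]) (simp add: \<pi>_def)
  have q2: "bij_betw \<pi> {Suc l..n} ({..n} - S)"
    using p2 by (rule bij_betw_cong[THEN iffD1, rotated]) (simp add: \<pi>_def)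
  have "{..l} \<union> {Suc l..n} = {..n}" "S \<union> ({..n} - S) = {..n}"
    using ln S by auto
  then have "bij_betw \<pi> {..n} {..n}"
    using bij_betw_combine[OF q1 q2] by simp
  then interpret perm: linear_change n "\<lambda>i. Q (\<pi> i)" "\<lambda>j i. P j (\<pi> i)"
    by (rule linear_change_permute)
  show ?thesis
  proof (rule perm.ST_type_if_initial_segment[OF f ln])
    fix i j assume "i \<le> l" "l < j" "j \<le> n"
    then have "\<pi> i \<in> S" "\<pi> j \<in> {..n} - S"
      using bij_betw_apply[OF q1, of i] bij_betw_apply[OF q2, of j] by simp_all
    then show "dir_diff n (Q (\<pi> j)) (dir_diff n (Q (\<pi> i)) f) = 0"
      by (rule mixed)
  qed
qed

end

section \<open>The Jacobian ideal in lowest degree\<close>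

lemma cring_poly_ring: "cring (poly_ring n)"
proof (rule cringI)
  show "abelian_group (poly_ring n)"
  proof (rule abelian_groupI)
    fix f assume "f \<in> carrier (poly_ring n)"
    then show "\<exists>g\<in>carrier (poly_ring n). g \<oplus>\<^bsub>poly_ring n\<^esub> f = \<zero>\<^bsub>poly_ring n\<^esub>"
      by (intro bexI[of _ "- f"]) (simp_all add: poly_ring_def polys_in_uminus)
  qed (simp_all add: poly_ring_def polys_in_add add_ac)
  show "comm_monoid (poly_ring n)"
    by (rule comm_monoidI) (simp_all add: poly_ring_def polys_in_mult mult_ac)
qed (simp add: poly_ring_def algebra_simps)

text \<open>The combinations with coefficients in the ring form an ideal \<open>I\<close> that
  contains the partial derivatives, hence also the ideal generated by them.\<close>

lemma jacobian_ideal_member: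
  assumes f: "f \<in> polys_in {..n}" and x: "x \<in> jacobian_ideal n f"
  shows "\<exists>r. x = (\<Sum>j\<le>n. r j * pdiff j f)"
proof -
  interpret cring "poly_ring n" by (rule cring_poly_ring)
  define I where "I = {\<Sum>j\<le>n. r j * pdiff j f | r. \<forall>j\<le>n. r j \<in> polys_in {..n}}"
  have car [simp]: "carrier (poly_ring n) = polys_in {..n}"
    by (simp add: poly_ring_def)
  have I_sub: "I \<subseteq> polys_in {..n}"
    using f by (auto simp: I_def intro!: polys_in_sum polys_in_mult polys_in_pdiff)
  have I_mult: "a * y \<in> I" if "y \<in> I" "a \<in> polys_in {..n}" for a y
  proof -
    obtain r where "y = (\<Sum>j\<le>n. r j * pdiff j f)" "\<forall>j\<le>n. r j \<in> polys_in {..n}"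
      using \<open>y \<in> I\<close> unfolding I_def by blast
    then show ?thesis
      unfolding I_def using that(2)
      by (intro CollectI exI[of _ "\<lambda>j. a * r j"]) (auto simp: sum_distrib_left mult.assoc intro: polys_in_mult)
  qed
  have I_mult': "y * a \<in> I" if "y \<in> I" "a \<in> polys_in {..n}" for a y
    using I_mult[OF that] by (simp only: mult.commute)
  have I_add: "y + z \<in> I" if yz: "y \<in> I" "z \<in> I" for y z
  proof -
    obtain r s where "y = (\<Sum>j\<le>n. r j * pdiff j f)" "z = (\<Sum>j\<le>n. s j * pdiff j f)"
      "\<forall>j\<le>n. r j \<in> polys_in {..n}" "\<forall>j\<le>n. s j \<in> polys_in {..n}"
      using yz unfolding I_def by blast
    then show ?thesis
      unfolding I_def
      by (intro CollectI exI[of _ "\<lambda>j. r j + s j"]) (auto simp: distrib_right sum.distrib intro: polys_in_add)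
  qed
  have "subgroup I (add_monoid (poly_ring n))"
  proof
    show "I \<subseteq> carrier (add_monoid (poly_ring n))"
      using I_sub by simp
    show "\<one>\<^bsub>add_monoid (poly_ring n)\<^esub> \<in> I"
      unfolding I_def by (auto simp: poly_ring_def intro!: exI[of _ "\<lambda>_. 0"])
    show "y \<otimes>\<^bsub>add_monoid (poly_ring n)\<^esub> z \<in> I" if "y \<in> I" "z \<in> I" for y z
      using I_add[OF that] by (simp add: poly_ring_def)
    show "inv\<^bsub>add_monoid (poly_ring n)\<^esub> y \<in> I" if "y \<in> I" for y
    proof -
      have "\<ominus>\<^bsub>poly_ring n\<^esub> y = - y"
        using that I_sub
        by (intro minus_equality) (auto simp: poly_ring_def polys_in_uminus)
      moreover have "- y \<in> I"
        using I_mult[OF that, of "-1"] polys_in_uminus[of 1] by simp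
      ultimately show ?thesis
        by (simp add: a_inv_def)
    qed
  qed
  then have "ideal I (poly_ring n)"
    by (intro idealI ring_axioms)
      (auto simp: poly_ring_def intro: I_mult I_mult')
  moreover have "(\<lambda>i. pdiff i f) ` {..n} \<subseteq> I"
  proof
    fix y assume "y \<in> (\<lambda>i. pdiff i f) ` {..n}"
    then obtain i where "i \<le> n" "y = pdiff i f" by blast
    moreover have "(\<Sum>j\<le>n. (if j = i then 1 else 0) * pdiff j f) = (\<Sum>j\<le>n. if j = i then pdiff j f else 0)"
      by (intro sum.cong) auto
    ultimately show "y \<in> I"
      unfolding I_def by (intro CollectI exI[of _ "\<lambda>j. if j = i then 1 else 0"]) simp
  qed
  ultimately have "jacobian_ideal n f \<subseteq> I"
    unfolding jacobian_ideal_def by (rule genideal_minimal)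
  then show ?thesis
    using x by (auto simp: I_def)
qed

lemma pdiff_in_jacobian_ideal:
  assumes "f \<in> polys_in {..n}" "i \<le> n"
  shows "pdiff i f \<in> jacobian_ideal n f"
proof -
  interpret cring "poly_ring n" by (rule cring_poly_ring)
  have "(\<lambda>i. pdiff i f) ` {..n} \<subseteq> carrier (poly_ring n)"
    using assms by (auto simp: poly_ring_def polys_in_pdiff)
  from genideal_self[OF this] show ?thesis
    using assms by (auto simp: jacobian_ideal_def)
qed

text \<open>In the lowest degree of \<open>J\<^sub>f\<close> only the constant terms of the coefficients contribute.\<close>

lemma jacobian_ideal_lowest_degree:
  assumes f: "form n d f" and x: "x \<in> jacobian_ideal n f" "homog (d - 1) x"
  shows "\<exists>c. x = (\<Sum>j\<le>n. Const (c j) * pdiff j f)"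
proof -
  obtain r where r: "x = (\<Sum>j\<le>n. r j * pdiff j f)"
    using jacobian_ideal_member f x by (metis form_in_iff)
  define c where "c j = Poly_Mapping.lookup (r j) 0" for j
  \<comment> \<open>The contribution of the nonconstant parts of the coefficients. It is homogeneous
    of degree \<open>d - 1\<close>, yet all its monomials have larger degree, so it is 0.\<close>
  define y where "y = (\<Sum>j\<le>n. (r j - Const (c j)) * pdiff j f)"
  have y_eq: "y = x + (\<Sum>j\<le>n. Const (- c j) * pdiff j f)"
    by (simp add: y_def r left_diff_distrib sum_subtractf Const.hom_uminus sum_negf)
  have pf: "homog (d - 1) (pdiff j f)" for j
    using f by (intro homog_pdiff) (simp add: form_in_iff)
  then have "homog (d - 1) y"
    unfolding y_eq using x by (intro homog_add homog_sum homog_Const_mult)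
  moreover have "mdeg m > d - 1" if m: "m \<in> Poly_Mapping.keys y" for m
  proof -
    obtain j where "m \<in> Poly_Mapping.keys ((r j - Const (c j)) * pdiff j f)"
      using m keys_sum[of "\<lambda>j. (r j - Const (c j)) * pdiff j f" "{..n}"] unfolding y_def by blast
    then obtain a b where ab: "m = a + b" "a \<in> Poly_Mapping.keys (r j - Const (c j))"
      "b \<in> Poly_Mapping.keys (pdiff j f)"
      using keys_mult by blast
    then have "a \<noteq> 0"
      by (auto simp: in_keys_iff c_def lookup_minus Const_def)
    then have "mdeg a > 0"
      by (simp add: zero_less_iff_neq_zero)
    then show ?thesis
      using ab pf[of j] by (simp add: mdeg_add homog_def)
  qed
  ultimately have "Poly_Mapping.keys y = {}"
    by (fastforce simp: homog_def)
  then have "x = (\<Sum>j\<le>n. Const (c j) * pdiff j f)"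
    using y_eq by (simp add: Const.hom_uminus sum_negf)
  then show ?thesis
    by (intro exI)
qed

section \<open>Jordan bases\<close>

text \<open>Replaces the block structure by the diagonal \<open>a\<close> and the superdiagonal
  \<open>\<epsilon>\<close>. Inside a block \<open>\<epsilon>\<close> is 1, at its last index 0, so
  it links equal eigenvalues only.\<close>

lemma jordan_matrix_bidiagonal:
  fixes n_as :: "(nat \<times> 'a::{zero,one}) list"
  defines "N \<equiv> sum_list (map fst n_as)"
  shows "\<exists>a \<epsilon>. (\<forall>i<N. \<forall>j<N. jordan_matrix n_as $$ (i, j)
            = (if i = j then a i else if Suc i = j then \<epsilon> i else 0))
          \<and> (\<forall>i. Suc i < N \<longrightarrow> \<epsilon> i \<noteq> 0 \<longrightarrow> a i = a (Suc i))"
  unfolding N_def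
proof (induction n_as)
  case Nil
  then show ?case by simp
next
  case (Cons na n_as)
  obtain k x where na: "na = (k, x)" by fastforce
  let ?N = "sum_list (map fst n_as)"
  obtain a \<epsilon> where IH: "\<forall>i<?N. \<forall>j<?N. jordan_matrix n_as $$ (i, j)
            = (if i = j then a i else if Suc i = j then \<epsilon> i else 0)"
      "\<forall>i. Suc i < ?N \<longrightarrow> \<epsilon> i \<noteq> 0 \<longrightarrow> a i = a (Suc i)"
    using Cons.IH by blast
  define a' where "a' i = (if i < k then x else a (i - k))" for i
  define \<epsilon>' where "\<epsilon>' i = (if Suc i < k then 1 else if i < k then 0 else \<epsilon> (i - k))" for i
  have "jordan_matrix (na # n_as) $$ (i, j)
      = (if i = j then a' i else if Suc i = j then \<epsilon>' i else 0)"
    if "i < k + ?N" "j < k + ?N" for i j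
  proof -
    consider "i < k" "j < k" | "i < k" "\<not> j < k" | "\<not> i < k" "j < k" | "\<not> i < k" "\<not> j < k"
      by blast
    then show ?thesis
      using that IH(1)
      by cases (auto simp: na jordan_matrix_Cons a'_def \<epsilon>'_def less_diff_conv2)
  qed
  moreover have "\<forall>i. Suc i < k + ?N \<longrightarrow> \<epsilon>' i \<noteq> 0 \<longrightarrow> a' i = a' (Suc i)"
    using IH(2) by (auto simp: a'_def \<epsilon>'_def Suc_diff_le split: if_splits)
  ultimately show ?case
    using na by auto
qed

text \<open>If \<open>M = U * J * V\<close> with \<open>J\<close> in Jordan form and
  \<open>V\<close> inverse to \<open>U\<close>, then \<open>V * M = J * V\<close>, and the rows of
  \<open>V\<close> are the basis. Row vectors are needed because the direction \<open>Q i\<close> is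
  paired from the left with \<open>A\<close> times a gradient.\<close>

lemma jordan_basis:
  fixes A :: "nat \<Rightarrow> nat \<Rightarrow> complex"
  shows "\<exists>Q P a \<epsilon>. linear_change n Q P
    \<and> (\<forall>i\<le>n. \<forall>j\<le>n. (\<Sum>k\<le>n. Q i k * A k j) = a i * Q i j + \<epsilon> i * Q (Suc i) j)
    \<and> (\<forall>i<n. \<epsilon> i \<noteq> 0 \<longrightarrow> a (Suc i) = a i) \<and> \<epsilon> n = 0"
proof -
  define M where "M = mat (Suc n) (Suc n) (\<lambda>(i, j). A i j)"
  have M: "M \<in> carrier_mat (Suc n) (Suc n)"
    by (simp add: M_def)
  obtain as where "char_poly M = (\<Prod>a\<leftarrow>as. [:- a, 1:])"
    using char_poly_factorized[OF M] by auto
  then obtain n_as where "jordan_nf M n_as"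
    using jordan_nf_exists[OF M] by blast
  then obtain U V where "similar_mat_wit M (jordan_matrix n_as) U V"
    by (auto simp: jordan_nf_def similar_mat_def)
  note sim = similar_mat_witD2[OF M this]
  let ?J = "jordan_matrix n_as"
  have dims: "?J \<in> carrier_mat (Suc n) (Suc n)" "U \<in> carrier_mat (Suc n) (Suc n)"
    "V \<in> carrier_mat (Suc n) (Suc n)"
    using sim by auto
  have size: "sum_list (map fst n_as) = Suc n"
    using dims(1) by auto
  have VM: "V * M = ?J * V"
  proof -
    have "V * M = V * (U * (?J * V))"
      using sim dims by (simp add: assoc_mult_mat[of U "Suc n" "Suc n" ?J "Suc n" V])
    also have "\<dots> = (V * U) * (?J * V)"
      using dims by (intro assoc_mult_mat[symmetric, of _ "Suc n" "Suc n" _ "Suc n" _ "Suc n"]) auto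
    also have "\<dots> = ?J * V"
      using sim(2) dims by (simp add: left_mult_one_mat[of _ _ "Suc n"])
    finally show ?thesis .
  qed
  obtain a \<epsilon> where J: "\<forall>i<Suc n. \<forall>j<Suc n. ?J $$ (i, j)
            = (if i = j then a i else if Suc i = j then \<epsilon> i else 0)"
      "\<forall>i. Suc i < Suc n \<longrightarrow> \<epsilon> i \<noteq> 0 \<longrightarrow> a i = a (Suc i)"
    using jordan_matrix_bidiagonal[of n_as] unfolding size by blast
  define Q where "Q i j = V $$ (i, j)" for i j
  define P where "P i j = U $$ (i, j)" for i j
  \<comment> \<open>Nothing constrains \<open>\<epsilon> n\<close>, as the matrix has no column
    \<open>Suc n\<close>. The value 0 removes the term with \<open>Q (Suc n)\<close>, which is no
    basis vector.\<close>
  define \<epsilon>' where "\<epsilon>' i = (if i < n then \<epsilon> i else 0)" for i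
  have prod_entry: "(X * Y) $$ (i, j) = (\<Sum>k\<le>n. X $$ (i, k) * Y $$ (k, j))"
    if "X \<in> carrier_mat (Suc n) (Suc n)" "Y \<in> carrier_mat (Suc n) (Suc n)" "i \<le> n" "j \<le> n"
    for X Y :: "complex mat" and i j
    using that by (simp add: scalar_prod_def atLeast0LessThan lessThan_Suc_atMost less_Suc_eq_le)
  show ?thesis
  proof (intro exI conjI allI impI)
    show "linear_change n Q P"
    proof
      fix i k assume "i \<le> n" "k \<le> n"
      then show "(\<Sum>j\<le>n. Q i j * P j k) = (if i = k then 1 else 0)"
        "(\<Sum>j\<le>n. P i j * Q j k) = (if i = k then 1 else 0)"
        using prod_entry[of V U i k] prod_entry[of U V i k] dims sim by (auto simp: Q_def P_def)
    qed
  next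
    fix i j assume ij: "i \<le> n" "j \<le> n"
    have "(\<Sum>k\<le>n. Q i k * A k j) = (V * M) $$ (i, j)"
      using prod_entry[of V M i j] dims M ij by (simp add: Q_def M_def less_Suc_eq_le)
    also have "\<dots> = (\<Sum>k\<le>n. ?J $$ (i, k) * V $$ (k, j))"
      unfolding VM using dims(1,3) ij by (rule prod_entry)
    also have "\<dots> = (\<Sum>k\<le>n. (if k = i then a i * V $$ (k, j) else 0)
        + (if k = Suc i then \<epsilon> i * V $$ (k, j) else 0))"
      using J(1) ij by (intro sum.cong) auto
    also have "\<dots> = a i * Q i j + \<epsilon>' i * Q (Suc i) j"
      using ij by (simp add: sum.distrib Q_def \<epsilon>'_def)
    finally show "(\<Sum>k\<le>n. Q i k * A k j) = a i * Q i j + \<epsilon>' i * Q (Suc i) j" .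
  next
    show "a (Suc i) = a i" if "i < n" "\<epsilon>' i \<noteq> 0" for i
      using that J(2) by (auto simp: \<epsilon>'_def)
    show "\<epsilon>' n = 0"
      by (simp add: \<epsilon>'_def)
  qed
qed

section \<open>Powers of the maximal ideal of a point\<close>

interpretation to_fract: comm_ring_hom to_fract
  by unfold_locales simp_all

text \<open>With \<open>homog\<close> in place of \<open>form\<close> the zero numerator is no
  longer a special case.\<close>

lemma carrier_local_ring:
  "carrier (local_ring n p) = {to_fract a / to_fract b | a b e.
     a \<in> polys_in {..n} \<and> homog e a \<and> b \<in> polys_in {..n} \<and> homog e b \<and> poly_eval p b \<noteq> 0}"
  unfolding local_ring_def form_in_iff Fract_conv_to_fract
  by (auto; metis homog_0 polys_in_0 poly_eval.hom_zero to_fract_0)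

lemma local_max_ideal_eq:
  "local_max_ideal n p = {to_fract a / to_fract b | a b e.
     a \<in> polys_in {..n} \<and> homog e a \<and> b \<in> polys_in {..n} \<and> homog e b \<and> poly_eval p b \<noteq> 0
     \<and> poly_eval p a = 0}"
  unfolding local_max_ideal_def form_in_iff Fract_conv_to_fract
  by (auto; metis homog_0 polys_in_0 poly_eval.hom_zero to_fract_0)

lemma in_carrier_local_ringE:
  assumes "x \<in> carrier (local_ring n p)"
  obtains a b e where "x = to_fract a / to_fract b" "a \<in> polys_in {..n}" "homog e a"
    "b \<in> polys_in {..n}" "homog e b" "poly_eval p b \<noteq> 0"
  using assms unfolding carrier_local_ring by blast

lemma in_local_max_idealE:
  assumes "x \<in> local_max_ideal n p"
  obtains a b e where "x = to_fract a / to_fract b" "a \<in> polys_in {..n}" "homog e a"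
    "b \<in> polys_in {..n}" "homog e b" "poly_eval p b \<noteq> 0" "poly_eval p a = 0"
  using assms unfolding local_max_ideal_eq by blast

lemma carrier_local_ringI:
  "a \<in> polys_in {..n} \<Longrightarrow> homog e a \<Longrightarrow> b \<in> polys_in {..n} \<Longrightarrow> homog e b \<Longrightarrow>
    poly_eval p b \<noteq> 0 \<Longrightarrow> to_fract a / to_fract b \<in> carrier (local_ring n p)"
  unfolding carrier_local_ring by blast

lemma local_max_idealI:
  "a \<in> polys_in {..n} \<Longrightarrow> homog e a \<Longrightarrow> b \<in> polys_in {..n} \<Longrightarrow> homog e b \<Longrightarrow>
    poly_eval p b \<noteq> 0 \<Longrightarrow> poly_eval p a = 0 \<Longrightarrow> to_fract a / to_fract b \<in> local_max_ideal n p"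
  unfolding local_max_ideal_eq by blast

lemma local_max_ideal_subset: "local_max_ideal n p \<subseteq> carrier (local_ring n p)"
  unfolding local_max_ideal_eq carrier_local_ring by blast

lemma to_fract_Const_in_local_ring: "to_fract (Const c) \<in> carrier (local_ring n p)"
  using carrier_local_ringI[of "Const c" n 0 1 p] homog_Const[of c] homog_Const[of 1] by simp

lemma local_ring_mult:
  assumes "x \<in> carrier (local_ring n p)" "y \<in> carrier (local_ring n p)"
  shows "x * y \<in> carrier (local_ring n p)"
  using assms(1)
proof (rule in_carrier_local_ringE)
  fix a b e assume x: "x = to_fract a / to_fract b" "a \<in> polys_in {..n}" "homog e a"
    "b \<in> polys_in {..n}" "homog e b" "poly_eval p b \<noteq> 0"
  from assms(2) show ?thesis
  proof (rule in_carrier_local_ringE)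
    fix a' b' e' assume "y = to_fract a' / to_fract b'" "a' \<in> polys_in {..n}" "homog e' a'"
      "b' \<in> polys_in {..n}" "homog e' b'" "poly_eval p b' \<noteq> 0"
    then show ?thesis
      using carrier_local_ringI[of "a * a'" n "e + e'" "b * b'" p] x
      by (simp add: polys_in_mult homog_mult poly_eval.hom_mult)
  qed
qed

lemma local_ring_add:
  assumes "x \<in> carrier (local_ring n p)" "y \<in> carrier (local_ring n p)"
  shows "x + y \<in> carrier (local_ring n p)"
  using assms(1)
proof (rule in_carrier_local_ringE)
  fix a b e assume x: "x = to_fract a / to_fract b" "a \<in> polys_in {..n}" "homog e a"
    "b \<in> polys_in {..n}" "homog e b" "poly_eval p b \<noteq> 0"
  from assms(2) show ?thesis
  proof (rule in_carrier_local_ringE)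
    fix a' b' e' assume y: "y = to_fract a' / to_fract b'" "a' \<in> polys_in {..n}" "homog e' a'"
      "b' \<in> polys_in {..n}" "homog e' b'" "poly_eval p b' \<noteq> 0"
    have "homog (e + e') (a * b' + a' * b)"
      using x y homog_mult[of e a e' b'] homog_mult[of e' a' e b]
      by (simp add: homog_add add.commute)
    moreover have "b \<noteq> 0" "b' \<noteq> 0"
      using x y by auto
    ultimately show ?thesis
      using carrier_local_ringI[of "a * b' + a' * b" n "e + e'" "b * b'" p] x y
      by (simp add: polys_in_mult polys_in_add homog_mult poly_eval.hom_mult add_frac_eq)
  qed
qed

lemma local_max_ideal_power_0 [simp]:
  "local_max_ideal_power n p 0 = carrier (local_ring n p)"
  by (simp add: local_max_ideal_power_def nat_pow_def ideals_set_def)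

lemma local_max_ideal_power_Suc [simp]:
  "local_max_ideal_power n p (Suc r)
     = ideal_prod (local_ring n p) (local_max_ideal_power n p r) (local_max_ideal n p)"
  by (simp add: local_max_ideal_power_def nat_pow_def ideals_set_def)

lemma local_max_ideal_power_SucI:
  assumes "x \<in> local_max_ideal_power n p r" "y \<in> local_max_ideal n p"
  shows "x * y \<in> local_max_ideal_power n p (Suc r)"
  using ideal_prod.prod[OF assms, of "local_ring n p"] by (simp add: local_ring_def)

lemma local_max_ideal_power_add:
  assumes "x \<in> local_max_ideal_power n p r" "y \<in> local_max_ideal_power n p r"
  shows "x + y \<in> local_max_ideal_power n p r"
proof (cases r)
  case 0
  then show ?thesis using assms by (simp add: local_ring_add)
next
  case (Suc s)
  then show ?thesis
    using assms ideal_prod.sum[of x "local_ring n p" "local_max_ideal_power n p s" "local_max_ideal n p" y]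
    by (simp add: local_ring_def)
qed

text \<open>A product of ideals consists of finite sums of products, so a property closed under sums
  need only be checked on products.\<close>

lemma local_max_ideal_power_Suc_induct [consumes 1, case_names mult add]:
  assumes "x \<in> local_max_ideal_power n p (Suc r)"
    and "\<And>u v. u \<in> local_max_ideal_power n p r \<Longrightarrow> v \<in> local_max_ideal n p \<Longrightarrow> R (u * v)"
    and "\<And>u v. R u \<Longrightarrow> R v \<Longrightarrow> R (u + v)"
  shows "R x"
  using assms(1) unfolding local_max_ideal_power_Suc
  by (induction rule: ideal_prod.induct) (use assms(2,3) in \<open>auto simp: local_ring_def\<close>)

lemma local_max_ideal_power_mult:
  assumes "x \<in> local_max_ideal_power n p r" "y \<in> local_max_ideal_power n p s"
  shows "x * y \<in> local_max_ideal_power n p (r + s)"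
  using assms
proof (induction s arbitrary: x y)
  case 0
  \<comment> \<open>The case \<open>s = 0\<close> says that the powers absorb elements of the local
    ring; it takes an induction on \<open>r\<close> of its own.\<close>
  have "y * x \<in> local_max_ideal_power n p r" if "y \<in> carrier (local_ring n p)"
    using 0(1) that
  proof (induction r arbitrary: x)
    case 0
    then show ?case by (simp add: local_ring_mult)
  next
    case (Suc r)
    from Suc.prems(1) show ?case
    proof (induction rule: local_max_ideal_power_Suc_induct)
      case (mult u v)
      then show ?case
        using local_max_ideal_power_SucI Suc.IH Suc.prems(2) by (simp only: mult.assoc[symmetric])
    next
      case (add u v)
      then show ?case
        by (simp only: distrib_left local_max_ideal_power_add)
    qed
  qed
  then show ?case using 0 by (simp add: mult.commute)
next
  case (Suc s)
  from Suc.prems(2) show ?case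
  proof (induction rule: local_max_ideal_power_Suc_induct)
    case (mult u v)
    then show ?case
      using local_max_ideal_power_SucI Suc.IH Suc.prems(1) by (simp only: mult.assoc[symmetric] add_Suc_right)
  next
    case (add u v)
    then show ?case
      by (simp only: distrib_left local_max_ideal_power_add)
  qed
qed

lemma local_max_ideal_power_Suc_subset:
  "local_max_ideal_power n p (Suc r) \<subseteq> local_max_ideal_power n p r"
proof
  fix x assume "x \<in> local_max_ideal_power n p (Suc r)"
  then show "x \<in> local_max_ideal_power n p r"
  proof (induction rule: local_max_ideal_power_Suc_induct)
    case (mult u v)
    then show ?case
      using local_max_ideal_power_mult[of u n p r v 0] local_max_ideal_subset by auto
  qed (rule local_max_ideal_power_add)
qed

lemma one_in_local_ring: "1 \<in> carrier (local_ring n p)"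
  using to_fract_Const_in_local_ring[of 1] by simp

lemma zero_in_local_max_ideal_power: "0 \<in> local_max_ideal_power n p r"
proof (induction r)
  case 0
  show ?case
    using to_fract_Const_in_local_ring[of 0] by simp
next
  case (Suc r)
  have "0 \<in> local_max_ideal n p"
    using local_max_idealI[of 0 n 0 1 p] homog_Const[of 1] by simp
  from local_max_ideal_power_SucI[OF Suc this] show ?case by simp
qed

lemma local_max_ideal_power_sum:
  "(\<And>a. a \<in> A \<Longrightarrow> F a \<in> local_max_ideal_power n p r) \<Longrightarrow> sum F A \<in> local_max_ideal_power n p r"
  by (induction A rule: infinite_finite_induct)
    (auto intro: local_max_ideal_power_add zero_in_local_max_ideal_power
      simp del: local_max_ideal_power_Suc)

lemma local_max_ideal_power_power:
  assumes "x \<in> local_max_ideal n p"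
  shows "x ^ r \<in> local_max_ideal_power n p r"
proof (induction r)
  case 0
  show ?case by (simp add: one_in_local_ring)
next
  case (Suc r)
  from local_max_ideal_power_SucI[OF this assms] show ?case
    by (simp add: mult.commute)
qed

lemma local_max_ideal_power_prod:
  assumes "\<And>i. i \<in> A \<Longrightarrow> z i \<in> local_max_ideal n p"
  shows "(\<Prod>i\<in>A. z i ^ r i) \<in> local_max_ideal_power n p (sum r A)"
  using assms
  by (induction A rule: infinite_finite_induct)
    (auto simp: one_in_local_ring intro!: local_max_ideal_power_mult local_max_ideal_power_power)

text \<open>Such a \<open>q\<close> has valuation 0: once the lower coefficients of \<open>p\<close>
  vanish, coefficient \<open>r\<close> of \<open>p * q\<close> is that of \<open>p\<close> times the
  constant coefficient of \<open>q\<close>.\<close>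

lemma monom_dvd_mult_cancel:
  fixes p q :: "'a::idom poly"
  assumes "Polynomial.monom 1 d dvd p * q" "Polynomial.coeff q 0 \<noteq> 0"
  shows "Polynomial.monom 1 d dvd p"
  unfolding monom_1_dvd_iff'
proof (intro allI impI)
  fix r assume "r < d"
  then show "Polynomial.coeff p r = 0"
  proof (induction r rule: less_induct)
    case (less r)
    have "Polynomial.coeff (p * q) r
        = (\<Sum>i\<le>r. Polynomial.coeff p i * Polynomial.coeff q (r - i))"
      by (rule coeff_mult)
    also have "\<dots> = (\<Sum>i\<in>{r}. Polynomial.coeff p i * Polynomial.coeff q (r - i))"
      using less by (intro sum.mono_neutral_right) auto
    finally show ?case
      using assms less.prems unfolding monom_1_dvd_iff' by simp
  qed
qed

section \<open>The order of vanishing at a basis point\<close>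

context linear_change
begin

text \<open>Substituting \<open>y\<^sub>i \<mapsto> t y\<^sub>i\<close> for \<open>i \<noteq> k\<close> in the coordinates \<open>y\<close> turns the order of
  vanishing at the point \<open>Q k\<close> into the \<open>t\<close>-adic valuation.\<close>

definition grading :: "nat \<Rightarrow> cpoly \<Rightarrow> cpoly poly" where
  "grading k = hom_eval (\<lambda>c. [:Const c:])
     (\<lambda>j. \<Sum>i\<le>n. Polynomial.monom (Const (Q i j) * Var i) (if i = k then 0 else 1))"

lemma comm_ring_hom_const_poly_Const: "comm_ring_hom (\<lambda>c. [:Const c:])"
  by unfold_locales (simp_all add: Const_add Const_mult one_pCons)

sublocale grading: comm_ring_hom "grading k" for k
  unfolding grading_def by (rule comm_ring_hom_hom_eval) (rule comm_ring_hom_const_poly_Const)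

lemma grading_Const [simp]: "grading k (Const c) = [:Const c:]"
  by (simp add: grading_def comm_ring_hom_const_poly_Const)

lemma grading_Var:
  "grading k (Var j)
     = (\<Sum>i\<le>n. Polynomial.monom (Const (Q i j) * Var i) (if i = k then 0 else 1))"
  by (simp add: grading_def comm_ring_hom_const_poly_Const)

text \<open>Setting \<open>t = 0\<close> restricts \<open>f\<close> to the line spanned by
  \<open>Q k\<close>. Hence a form vanishes at \<open>Q k\<close> exactly when its constant
  coefficient here is 0.\<close>

lemma coeff_0_grading:
  assumes "homog e f" "k \<le> n"
  shows "Polynomial.coeff (grading k f) 0 = Const (poly_eval (Q k) f) * Var k ^ e"
proof -
  interpret ev: comm_ring_hom "\<lambda>q :: cpoly poly. Polynomial.coeff q 0"
    by unfold_locales (simp_all add: coeff_mult_0)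
  have "Polynomial.coeff (grading k f) 0 = hom_eval Const (\<lambda>j. Const (Q k j) * Var k) f"
  proof -
    have "Polynomial.coeff (Polynomial.monom (Const (Q i j) * Var i) (if i = k then 0 else 1)) 0
        = (if i = k then Const (Q k j) * Var k else 0)" for i j
      by simp
    then have "Polynomial.coeff (\<Sum>i\<le>n. Polynomial.monom (Const (Q i j) * Var i) (if i = k then 0 else 1)) 0
        = Const (Q k j) * Var k" for j
      using assms(2) by (simp only: coeff_sum) simp
    then show ?thesis
      by (simp add: grading_def ev.hom_hom_eval)
  qed
  also have "\<dots> = (\<Sum>m\<in>Poly_Mapping.keys f.
      Const (Poly_Mapping.lookup f m * monom_eval (Q k) m) * Var k ^ e)"
    unfolding hom_eval_def
  proof (rule sum.cong)
    fix m assume "m \<in> Poly_Mapping.keys f"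
    then have "mdeg m = e"
      using assms by (simp add: homog_def)
    have "monom_eval (\<lambda>j. Const (Q k j) * Var k) m = Const (monom_eval (Q k) m) * Var k ^ mdeg m"
      by (simp add: monom_eval_def mdeg_def power_mult_distrib prod.distrib Const.hom_prod
          Const.hom_power power_sum)
    then show "Const (Poly_Mapping.lookup f m) * monom_eval (\<lambda>j. Const (Q k j) * Var k) m
        = Const (Poly_Mapping.lookup f m * monom_eval (Q k) m) * Var k ^ e"
      using \<open>mdeg m = e\<close> by (simp add: Const_mult)
  qed simp
  also have "\<dots> = Const (poly_eval (Q k) f) * Var k ^ e"
    by (simp add: poly_eval_eq_hom_eval hom_eval_def Const.hom_sum sum_distrib_right)
  finally show ?thesis .
qed

lemma Var_nonzero: "Var k \<noteq> 0"
proof -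
  have "poly_eval (\<lambda>_. 1) (Var k) \<noteq> poly_eval (\<lambda>_. 1) 0"
    by simp
  then show ?thesis by metis
qed

text \<open>The new coordinates are homogeneous for the grading, with weight 0 for index
  \<open>k\<close> and weight 1 otherwise, because \<open>P\<close> is dual to
  \<open>Q\<close>.\<close>

lemma grading_new_coord:
  assumes "i \<le> n"
  shows "grading k (new_coord i) = Polynomial.monom (Var i) (if i = k then 0 else 1)"
proof -
  let ?w = "\<lambda>l. if l = k then 0 else 1 :: nat"
  have "grading k (new_coord i)
      = (\<Sum>j\<le>n. \<Sum>l\<le>n. Polynomial.monom (Const (Q l j * P j i) * Var l) (?w l))"
    by (simp add: new_coord_def grading.hom_sum grading.hom_mult grading_Var
        sum_distrib_left smult_monom Const_mult mult_ac smult_sum2 cong: if_cong)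
  also have "\<dots> = (\<Sum>l\<le>n. Polynomial.monom (Const (\<Sum>j\<le>n. Q l j * P j i) * Var l) (?w l))"
    by (subst sum.swap) (simp add: monom_sum Const.hom_sum sum_distrib_right)
  also have "\<dots> = (\<Sum>l\<le>n. if l = i then Polynomial.monom (Var l) (?w l) else 0)"
    using assms by (intro sum.cong) (simp_all add: QP)
  also have "\<dots> = Polynomial.monom (Var i) (?w i)"
    using assms by simp
  finally show ?thesis .
qed

text \<open>The grading merely sorts the monomials of \<open>f\<close> in the new coordinates by
  their degree in the variables other than \<open>Var k\<close>, leaving coefficients
  unchanged.\<close>

lemma lookup_coeff_grading:
  assumes f: "f \<in> polys_in {..n}"
  shows "Poly_Mapping.lookup (Polynomial.coeff (grading k f)
           (\<Sum>i\<in>Poly_Mapping.keys m - {k}. Poly_Mapping.lookup m i)) m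
         = Poly_Mapping.lookup (subst_poly old_coord f) m"
proof -
  let ?f = "subst_poly old_coord f"
  let ?w = "\<lambda>l. if l = k then 0 else 1 :: nat"
  define wt where "wt m = (\<Sum>i\<in>Poly_Mapping.keys m - {k}. Poly_Mapping.lookup m i)"
    for m :: "nat \<Rightarrow>\<^sub>0 nat"
  have mono: "monom_eval (\<lambda>i. Polynomial.monom (Var i) (?w i)) m
      = Polynomial.monom (Poly_Mapping.single m 1) (wt m)" for m
  proof -
    have "(\<Prod>i\<in>A. Polynomial.monom (Var i) (?w i) ^ r i)
        = Polynomial.monom (\<Prod>i\<in>A. Var i ^ r i) (\<Sum>i\<in>A. ?w i * r i)" if "finite A" for A r
      using that
      by (induction A rule: finite_induct) (simp_all add: monom_power mult_monom)
    moreover have "(\<Sum>i\<in>Poly_Mapping.keys m. ?w i * Poly_Mapping.lookup m i) = wt m"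
      unfolding wt_def by (intro sum.mono_neutral_cong_right) (auto split: if_splits)
    ultimately show ?thesis
      by (simp add: monom_eval_def monom_eval_Var[symmetric])
  qed
  have "grading k f = grading k (subst_poly new_coord ?f)"
    using f by (simp add: subst_new_old)
  also have "\<dots> = hom_eval (\<lambda>c. [:Const c:]) (\<lambda>i. grading k (new_coord i)) ?f"
    by (simp add: hom_subst_poly[OF grading.comm_ring_hom_axioms])
  also have "\<dots> = hom_eval (\<lambda>c. [:Const c:]) (\<lambda>i. Polynomial.monom (Var i) (?w i)) ?f"
    using polys_in_subst_old[OF f] by (rule hom_eval_cong) (simp_all add: grading_new_coord)
  also have "\<dots> = (\<Sum>m'\<in>Poly_Mapping.keys ?f.
      Polynomial.monom (Poly_Mapping.single m' (Poly_Mapping.lookup ?f m')) (wt m'))"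
    by (simp add: hom_eval_def mono smult_monom Const_mult_single)
  finally have "Poly_Mapping.lookup (Polynomial.coeff (grading k f) (wt m)) m
      = (\<Sum>m'\<in>Poly_Mapping.keys ?f. Poly_Mapping.lookup (if wt m' = wt m
          then Poly_Mapping.single m' (Poly_Mapping.lookup ?f m') else 0) m)"
    by (simp add: coeff_sum lookup_sum)
  also have "\<dots> = (\<Sum>m'\<in>Poly_Mapping.keys ?f. if m' = m then Poly_Mapping.lookup ?f m else 0)"
    by (intro sum.cong) (auto simp: lookup_single when_def)
  also have "\<dots> = Poly_Mapping.lookup ?f m"
    by (simp add: in_keys_iff)
  finally show ?thesis
    by (simp add: wt_def)
qed

text \<open>Elements of the \<open>r\<close>-th power have valuation at least \<open>r\<close>: a
  numerator vanishing at \<open>Q k\<close> is divisible by \<open>t\<close>, products add up, and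
  sums are brought to a common denominator. Denominators keep a nonzero constant coefficient, so the
  numerator carries the valuation.\<close>

lemma local_max_ideal_power_grading:
  assumes "x \<in> local_max_ideal_power n (Q k) r" and k: "k \<le> n"
  shows "\<exists>a b. x = to_fract a / to_fract b \<and> Polynomial.coeff (grading k b) 0 \<noteq> 0
           \<and> Polynomial.monom 1 r dvd grading k a"
  using assms(1)
proof (induction r arbitrary: x)
  case 0
  then have "x \<in> carrier (local_ring n (Q k))" by simp
  then show ?case
  proof (rule in_carrier_local_ringE)
    fix a b e assume x: "x = to_fract a / to_fract b" "homog e b" "poly_eval (Q k) b \<noteq> 0"
    then have "Polynomial.coeff (grading k b) 0 \<noteq> 0"
      using k by (simp add: coeff_0_grading Var_nonzero)
    moreover have "Polynomial.monom 1 0 dvd grading k a"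
      unfolding monom_1_dvd_iff' by simp
    ultimately show ?thesis
      using x(1) by blast
  qed
next
  case (Suc r)
  from Suc.prems show ?case
  proof (induction rule: local_max_ideal_power_Suc_induct)
    case (mult u v)
    obtain a b where u: "u = to_fract a / to_fract b" "Polynomial.coeff (grading k b) 0 \<noteq> 0"
      "Polynomial.monom 1 r dvd grading k a"
      using Suc.IH[OF mult(1)] by blast
    obtain a' b' e where v: "v = to_fract a' / to_fract b'" "homog e a'" "homog e b'"
      "poly_eval (Q k) b' \<noteq> 0" "poly_eval (Q k) a' = 0"
      using mult(2) by (rule in_local_max_idealE) blast
    have "Polynomial.monom 1 1 dvd grading k a'"
      unfolding monom_1_dvd_iff' using v k by (simp add: coeff_0_grading)
    then have "Polynomial.monom 1 r * Polynomial.monom 1 1 dvd grading k (a * a')"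
      using u(3) unfolding grading.hom_mult by (intro mult_dvd_mono)
    then show ?case
      using u v k
      by (intro exI[of _ "a * a'"] exI[of _ "b * b'"])
        (simp add: mult_monom grading.hom_mult coeff_mult_0 coeff_0_grading Var_nonzero)
  next
    case (add u v)
    obtain a b where u: "u = to_fract a / to_fract b" "Polynomial.coeff (grading k b) 0 \<noteq> 0"
      "Polynomial.monom 1 (Suc r) dvd grading k a"
      using add(1) by blast
    obtain a' b' where v: "v = to_fract a' / to_fract b'" "Polynomial.coeff (grading k b') 0 \<noteq> 0"
      "Polynomial.monom 1 (Suc r) dvd grading k a'"
      using add(2) by blast
    have "b \<noteq> 0" "b' \<noteq> 0"
      using u v by auto
    then show ?case
      using u v
      by (intro exI[of _ "a * b' + a' * b"] exI[of _ "b * b'"])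
        (simp add: grading.hom_mult grading.hom_add coeff_mult_0 add_frac_eq)
  qed
qed

lemma poly_eval_new_coord:
  assumes "k \<le> n" "i \<le> n"
  shows "poly_eval (Q k) (new_coord i) = (if i = k then 1 else 0)"
  using QP[OF assms]
  by (auto simp: new_coord_def poly_eval.hom_sum poly_eval.hom_mult mult.commute)

lemma new_coord_nonzero:
  assumes "k \<le> n"
  shows "new_coord k \<noteq> 0"
  using poly_eval_new_coord[OF assms assms] by auto

lemma polys_in_new_coord: "new_coord i \<in> polys_in {..n}"
  by (auto simp: new_coord_def intro!: polys_in_sum polys_in_mult)

section \<open>Multiplicity \<open>d - 1\<close> at \<open>Q k\<close> for a form of degree 1 in the
  coordinate of \<open>Q k\<close>\<close>

context
  fixes f d k
  assumes f: "form n d f" and d: "d \<ge> 3" and k: "k \<le> n"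
    and second: "dir_diff n (Q k) (dir_diff n (Q k) f) = 0"
    and first: "dir_diff n (Q k) f \<noteq> 0"
begin

lemma form_facts: "f \<in> polys_in {..n}" "homog d f"
  using f by (simp_all add: form_in_iff)

lemma exponent_le_1:
  assumes "m \<in> Poly_Mapping.keys (subst_poly old_coord f)"
  shows "Poly_Mapping.lookup m k \<le> 1"
proof (rule ccontr)
  assume "\<not> Poly_Mapping.lookup m k \<le> 1"
  then have "m - expo k - expo k + expo k + expo k = m"
    by (intro poly_mapping_eqI) (auto simp: lookup_add lookup_minus lookup_single when_def)
  then have "Poly_Mapping.lookup (subst_poly old_coord f) m = 0"
    using lookup_subst_old_eq_0[OF form_facts(1) k k second, of "m - expo k - expo k"] by simp
  then show False
    using assms by (simp add: in_keys_iff)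
qed

lemma mdeg_split:
  assumes "m \<in> Poly_Mapping.keys (subst_poly old_coord f)"
  shows "Poly_Mapping.lookup m k + (\<Sum>i\<in>{..n} - {k}. Poly_Mapping.lookup m i) = d"
proof -
  have "homog d (subst_poly old_coord f)"
    using form_facts(2,1) homog_old_coord by (rule homog_subst_poly)
  then have "mdeg m = d"
    using assms by (simp add: homog_def)
  moreover have "Poly_Mapping.keys m \<subseteq> {..n}"
    using assms polys_in_subst_old[OF form_facts(1)] by (auto simp: polys_in_def)
  ultimately show ?thesis
    using k by (simp add: mdeg_superset[of "{..n}"] sum.remove[of "{..n}" k])
qed

text \<open>Makes \<open>new_coord k ^ d\<close> an admissible denominator for a local equation at
  \<open>Q k\<close>.\<close>

lemma new_coord_power: "form n d (new_coord k ^ d)" "poly_eval (Q k) (new_coord k ^ d) = 1"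
proof -
  show ev: "poly_eval (Q k) (new_coord k ^ d) = 1"
    using k by (simp add: poly_eval.hom_power poly_eval_new_coord)
  have "new_coord k ^ r \<in> polys_in {..n}" for r
    by (induction r) (auto intro: polys_in_mult polys_in_new_coord)
  then show "form n d (new_coord k ^ d)"
    using homog_power[OF homog_new_coord, of d k] new_coord_nonzero[OF k] by (simp add: form_in_iff)
qed

text \<open>Dehomogenisation: the quotients \<open>z i\<close> are affine coordinates centred at
  \<open>Q k\<close>, and division by \<open>new_coord k ^ d\<close> cancels the coordinate of index
  \<open>k\<close>.\<close>

lemma local_equation_expansion:
  defines "z i \<equiv> to_fract (new_coord i) / to_fract (new_coord k)"
  shows "Fraction_Field.Fract f (new_coord k ^ d) = (\<Sum>m\<in>Poly_Mapping.keys (subst_poly old_coord f).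
      to_fract (Const (Poly_Mapping.lookup (subst_poly old_coord f) m))
        * (\<Prod>i\<in>{..n} - {k}. z i ^ Poly_Mapping.lookup m i))"
proof -
  let ?f = "subst_poly old_coord f"
  let ?y = "to_fract (new_coord k)"
  have y: "?y \<noteq> 0"
    using new_coord_nonzero[OF k] by simp
  have "to_fract f = to_fract (subst_poly new_coord ?f)"
    using form_facts by (simp add: subst_new_old)
  also have "\<dots> = hom_eval (\<lambda>c. to_fract (Const c)) (\<lambda>i. to_fract (new_coord i)) ?f"
    by (rule hom_subst_poly[OF to_fract.comm_ring_hom_axioms])
  finally have "Fraction_Field.Fract f (new_coord k ^ d)
      = (\<Sum>m\<in>Poly_Mapping.keys ?f. to_fract (Const (Poly_Mapping.lookup ?f m))
          * (monom_eval (\<lambda>i. to_fract (new_coord i)) m / ?y ^ d))"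
    by (simp add: Fract_conv_to_fract hom_eval_def sum_divide_distrib to_fract.hom_power)
  also have "\<dots> = (\<Sum>m\<in>Poly_Mapping.keys ?f. to_fract (Const (Poly_Mapping.lookup ?f m))
          * (\<Prod>i\<in>{..n} - {k}. z i ^ Poly_Mapping.lookup m i))"
  proof (intro sum.cong refl arg_cong[of _ _ "(*) _"])
    fix m assume m: "m \<in> Poly_Mapping.keys ?f"
    have "Poly_Mapping.keys m \<subseteq> {..n}"
      using m polys_in_subst_old[OF form_facts(1)] by (auto simp: polys_in_def)
    then have "monom_eval (\<lambda>i. to_fract (new_coord i)) m
        = ?y ^ Poly_Mapping.lookup m k * (\<Prod>i\<in>{..n} - {k}. to_fract (new_coord i) ^ Poly_Mapping.lookup m i)"
      using k by (simp add: monom_eval_superset[of "{..n}"] prod.remove[of "{..n}" k])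
    moreover have "?y ^ d = ?y ^ Poly_Mapping.lookup m k * (\<Prod>i\<in>{..n} - {k}. ?y ^ Poly_Mapping.lookup m i)"
      using mdeg_split[OF m] by (simp add: power_add[symmetric] power_sum[symmetric])
    ultimately show "monom_eval (\<lambda>i. to_fract (new_coord i)) m / ?y ^ d
        = (\<Prod>i\<in>{..n} - {k}. z i ^ Poly_Mapping.lookup m i)"
      using y by (simp add: z_def power_divide prod_dividef)
  qed
  finally show ?thesis .
qed

text \<open>Each \<open>z i\<close> lies in the maximal ideal, and each term contains at least
  \<open>d - 1\<close> of them since the coordinate of index \<open>k\<close> occurs at most
  once.\<close>

lemma local_equation_in_power:
  "Fraction_Field.Fract f (new_coord k ^ d) \<in> local_max_ideal_power n (Q k) (d - 1)"
  unfolding local_equation_expansion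
proof (rule local_max_ideal_power_sum)
  fix m assume m: "m \<in> Poly_Mapping.keys (subst_poly old_coord f)"
  let ?z = "\<lambda>i. to_fract (new_coord i) / to_fract (new_coord k)"
  let ?c = "to_fract (Const (Poly_Mapping.lookup (subst_poly old_coord f) m))"
  let ?e = "\<Sum>i\<in>{..n} - {k}. Poly_Mapping.lookup m i"
  have "?z i \<in> local_max_ideal n (Q k)" if "i \<in> {..n} - {k}" for i
    by (rule local_max_idealI[OF polys_in_new_coord homog_new_coord polys_in_new_coord homog_new_coord])
      (use that k in \<open>simp_all add: poly_eval_new_coord\<close>)
  then have "(\<Prod>i\<in>{..n} - {k}. ?z i ^ Poly_Mapping.lookup m i) \<in> local_max_ideal_power n (Q k) ?e"
    by (rule local_max_ideal_power_prod)
  then have "?c * (\<Prod>i\<in>{..n} - {k}. ?z i ^ Poly_Mapping.lookup m i) \<in> local_max_ideal_power n (Q k) (0 + ?e)"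
    by (intro local_max_ideal_power_mult) (simp_all add: to_fract_Const_in_local_ring)
  moreover have "?e = d - 1 \<or> ?e = Suc (d - 1)"
    using mdeg_split[OF m] exponent_le_1[OF m] d by linarith
  ultimately show "?c * (\<Prod>i\<in>{..n} - {k}. ?z i ^ Poly_Mapping.lookup m i)
      \<in> local_max_ideal_power n (Q k) (d - 1)"
    using local_max_ideal_power_Suc_subset[of n "Q k" "d - 1"] by auto
qed

text \<open>As \<open>dir_diff n (Q k) f\<close> is nonzero, some monomial involves
  \<open>Var k\<close>. Its degree in the other variables is below \<open>d\<close>, so it yields a
  nonzero coefficient there.\<close>

lemma grading_not_dvd: "\<not> Polynomial.monom 1 d dvd grading k f"
proof
  let ?f = "subst_poly old_coord f"
  assume dvd: "Polynomial.monom 1 d dvd grading k f"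
  have "subst_poly old_coord (dir_diff n (Q k) f) \<noteq> 0"
    using first subst_new_old[OF polys_in_dir_diff[OF form_facts(1)]]
    by (metis subst_poly.hom_zero)
  then have "pdiff k ?f \<noteq> 0"
    using form_facts k by (simp add: pdiff_subst_old)
  then obtain m0 where "Poly_Mapping.lookup (pdiff k ?f) m0 \<noteq> 0"
    by (metis lookup_zero poly_mapping_eqI)
  then have "Poly_Mapping.lookup ?f (m0 + expo k) \<noteq> 0"
    by (simp add: lookup_pdiff)
  then obtain m where m: "m \<in> Poly_Mapping.keys ?f" "Poly_Mapping.lookup m k \<ge> 1"
    by (metis add.commute in_keys_iff le_add1 lookup_add lookup_single_eq)
  have "Poly_Mapping.keys m \<subseteq> {..n}"
    using m polys_in_subst_old[OF form_facts(1)] by (auto simp: polys_in_def)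
  then have "(\<Sum>i\<in>Poly_Mapping.keys m - {k}. Poly_Mapping.lookup m i)
      = (\<Sum>i\<in>{..n} - {k}. Poly_Mapping.lookup m i)"
    by (intro sum.mono_neutral_left) (auto simp: in_keys_iff)
  also have "\<dots> < d"
    using mdeg_split[OF m(1)] m(2) by linarith
  finally have "Polynomial.coeff (grading k f) (\<Sum>i\<in>Poly_Mapping.keys m - {k}. Poly_Mapping.lookup m i) = 0"
    using dvd unfolding monom_1_dvd_iff' by blast
  then show False
    using lookup_coeff_grading[OF form_facts(1), of k m] m(1) by (simp add: in_keys_iff)
qed

text \<open>Otherwise \<open>f * b = a * new_coord k ^ d\<close> where \<open>a\<close> has
  valuation at least \<open>d\<close> and \<open>b\<close> valuation 0. Then \<open>f\<close> would
  have valuation at least \<open>d\<close>.\<close>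

lemma local_equation_not_in_power:
  "Fraction_Field.Fract f (new_coord k ^ d) \<notin> local_max_ideal_power n (Q k) d"
proof
  assume "Fraction_Field.Fract f (new_coord k ^ d) \<in> local_max_ideal_power n (Q k) d"
  then obtain a b where ab: "to_fract f / to_fract (new_coord k ^ d) = to_fract a / to_fract b"
    "Polynomial.coeff (grading k b) 0 \<noteq> 0" "Polynomial.monom 1 d dvd grading k a"
    using local_max_ideal_power_grading[OF _ k] unfolding Fract_conv_to_fract by blast
  have "b \<noteq> 0" "new_coord k ^ d \<noteq> 0"
    using ab new_coord_power(1) by (auto simp: form_in_iff)
  then have "to_fract (f * b) = to_fract (a * new_coord k ^ d)"
    using ab(1) by (simp only: frac_eq_eq to_fract_eq_0_iff to_fract_mult not_False_eq_True)
  then have "grading k f * grading k b = grading k a * grading k (new_coord k ^ d)"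
    by (simp only: to_fract_eq_iff grading.hom_mult[symmetric])
  then have "Polynomial.monom 1 d dvd grading k f * grading k b"
    using ab(3) by simp
  then show False
    using ab(2) grading_not_dvd monom_dvd_mult_cancel by blast
qed

text \<open>All new coordinates except the one of index \<open>k\<close> vanish at
  \<open>Q k\<close>, and as \<open>d > 1\<close> every monomial contains one of those.\<close>

lemma poly_eval_eq_0: "poly_eval (Q k) f = 0"
proof -
  let ?f = "subst_poly old_coord f"
  have "poly_eval (Q k) f = hom_eval (\<lambda>c. c) (\<lambda>i. poly_eval (Q k) (new_coord i)) ?f"
    using subst_new_old[OF form_facts(1)]
      hom_subst_poly[OF poly_eval.comm_ring_hom_axioms, of "Q k" new_coord ?f]
    by simp
  also have "\<dots> = 0"
    unfolding hom_eval_def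
  proof (intro sum.neutral ballI)
    fix m assume m: "m \<in> Poly_Mapping.keys ?f"
    have "(\<Sum>i\<in>{..n} - {k}. Poly_Mapping.lookup m i) \<noteq> 0"
      using mdeg_split[OF m] exponent_le_1[OF m] d by linarith
    then obtain i where i: "i \<le> n" "i \<noteq> k" "Poly_Mapping.lookup m i \<noteq> 0"
      by (metis DiffE atMost_iff singletonI sum.neutral)
    have "monom_eval (\<lambda>i. poly_eval (Q k) (new_coord i)) m = 0"
      unfolding monom_eval_def
      using i k by (intro prod_zero bexI[of _ i]) (simp_all add: poly_eval_new_coord in_keys_iff)
    then show "Poly_Mapping.lookup ?f m * monom_eval (\<lambda>i. poly_eval (Q k) (new_coord i)) m = 0"
      by simp
  qed
  finally show ?thesis .
qed

lemma singularity_of_multiplicity_if_second_dir_diff_zero: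
  "singularity_of_multiplicity n f (Q k) (d - 1)"
proof -
  have "local_equation n f (Q k) (Fraction_Field.Fract f (new_coord k ^ d))"
    unfolding local_equation_def using f new_coord_power by force
  moreover have "Suc (d - 1) = d"
    using d by simp
  ultimately have "has_multiplicity n f (Q k) (d - 1)"
    unfolding has_multiplicity_def
    using local_equation_in_power local_equation_not_in_power by metis
  moreover have "\<exists>j\<le>n. Q k j \<noteq> 0"
  proof (rule ccontr)
    assume "\<not> ?thesis"
    then have "(\<Sum>j\<le>n. Q k j * P j k) = 0"
      by simp
    then show False
      using QP[OF k k] by simp
  qed
  ultimately show ?thesis
    using d poly_eval_eq_0 by (simp add: singularity_of_multiplicity_def proj_point_def)
qed

end

end

section \<open>Hypersurfaces with equal Jacobian ideals\<close>

lemma jordan_second_dir_diff: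
  fixes a \<epsilon> :: "nat \<Rightarrow> complex"
  assumes g: "\<And>i. i \<le> n \<Longrightarrow> dir_diff n (Q i) g
      = Const (a i) * dir_diff n (Q i) f + Const (\<epsilon> i) * dir_diff n (Q (Suc i)) f"
    and "i \<le> n" "j \<le> n"
  shows "Const (a i - a j) * dir_diff n (Q i) (dir_diff n (Q j) f)
       = Const (\<epsilon> j) * dir_diff n (Q i) (dir_diff n (Q (Suc j)) f)
       - Const (\<epsilon> i) * dir_diff n (Q (Suc i)) (dir_diff n (Q j) f)"
proof -
  have "dir_diff n (Q i) (dir_diff n (Q j) g) = dir_diff n (Q j) (dir_diff n (Q i) g)"
    by (rule dir_diff_commute)
  then have "Const (a j) * dir_diff n (Q i) (dir_diff n (Q j) f)
      + Const (\<epsilon> j) * dir_diff n (Q i) (dir_diff n (Q (Suc j)) f)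
    = Const (a i) * dir_diff n (Q i) (dir_diff n (Q j) f)
      + Const (\<epsilon> i) * dir_diff n (Q (Suc i)) (dir_diff n (Q j) f)"
    using assms(2,3)
    by (simp add: g dir_diff_add dir_diff_Const_mult dir_diff_commute[of n "Q j"])
  then have "Const (a i) * dir_diff n (Q i) (dir_diff n (Q j) f)
    = Const (a j) * dir_diff n (Q i) (dir_diff n (Q j) f)
      + Const (\<epsilon> j) * dir_diff n (Q i) (dir_diff n (Q (Suc j)) f)
      - Const (\<epsilon> i) * dir_diff n (Q (Suc i)) (dir_diff n (Q j) f)"
    by (simp only: eq_diff_eq)
  then show ?thesis
    by (simp add: Const.hom_minus left_diff_distrib)
qed

text \<open>Induction from the top indices downwards: an index is raised only where
  \<open>\<epsilon>\<close> is nonzero, which preserves its eigenvalue, so both terms on the right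
  of the symmetry relation vanish. Then \<open>a i - a j\<close> is cancelled. At index
  \<open>n\<close> the chain stops because \<open>\<epsilon> n = 0\<close>.\<close>

lemma jordan_eigenvalues_differ:
  fixes a \<epsilon> :: "nat \<Rightarrow> complex"
  assumes g: "\<And>i. i \<le> n \<Longrightarrow> dir_diff n (Q i) g
      = Const (a i) * dir_diff n (Q i) f + Const (\<epsilon> i) * dir_diff n (Q (Suc i)) f"
    and \<epsilon>: "\<And>i. i < n \<Longrightarrow> \<epsilon> i \<noteq> 0 \<Longrightarrow> a (Suc i) = a i" "\<epsilon> n = 0"
    and "i \<le> n" "j \<le> n" "a i \<noteq> a j"
  shows "dir_diff n (Q i) (dir_diff n (Q j) f) = 0"
  using assms(4-6)
proof (induction "(n - i) + (n - j)" arbitrary: i j rule: less_induct)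
  case less
  have "Const (\<epsilon> j) * dir_diff n (Q i) (dir_diff n (Q (Suc j)) f) = 0"
  proof (cases "\<epsilon> j = 0")
    case False
    then have "j < n" "a (Suc j) = a j"
      using \<epsilon> less.prems by (metis le_neq_implies_less)+
    then show ?thesis
      using less.hyps[of i "Suc j"] less.prems by simp
  qed simp
  moreover have "Const (\<epsilon> i) * dir_diff n (Q (Suc i)) (dir_diff n (Q j) f) = 0"
  proof (cases "\<epsilon> i = 0")
    case False
    then have "i < n" "a (Suc i) = a i"
      using \<epsilon> less.prems by (metis le_neq_implies_less)+
    then show ?thesis
      using less.hyps[of "Suc i" j] less.prems by simp
  qed simp
  ultimately have "Const (a i - a j) * dir_diff n (Q i) (dir_diff n (Q j) f) = 0"
    using jordan_second_dir_diff[of n Q g a f \<epsilon> i j, OF g less.prems(1,2)] by (simp only: diff_zero)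
  then show ?case
    using less.prems by simp
qed

text \<open>Euler's formula recovers both forms from their partial derivatives, giving
  \<open>g = Const c * f\<close>; here \<open>c\<close> is nonzero because \<open>g\<close>
  is.\<close>

lemma proportional_if_partials_proportional:
  assumes "form n d f" "form n d g" "d \<noteq> 0"
    and "\<And>i. i \<le> n \<Longrightarrow> pdiff i g = Const c * pdiff i f"
  shows "\<exists>c. c \<noteq> 0 \<and> f = Const c * g"
proof -
  have "of_nat d * g = Const c * (of_nat d * f)"
    unfolding Euler_formula[OF assms(1), symmetric] Euler_formula[OF assms(2), symmetric]
    using assms(4) by (simp add: sum_distrib_left mult.left_commute)
  then have "of_nat d * g = of_nat d * (Const c * f)"
    by (simp add: mult.left_commute)
  then have g: "g = Const c * f"
    using assms(3) by simp
  then have "c \<noteq> 0"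
    using assms(2) by (auto simp: form_in_iff)
  then show ?thesis
    by (intro exI[of _ "inverse c"]) (simp add: g mult.assoc[symmetric] Const_mult[symmetric])
qed

theorem theorem1p1:
  fixes n d :: nat and f g :: cpoly
  assumes "n \<ge> 1" and "d \<ge> 3"
    and "form n d f" and "form n d g"
    and "\<not> (\<exists>c. c \<noteq> 0 \<and> f = Const c * g)"
    and "jacobian_ideal n f = jacobian_ideal n g"
  shows "(\<exists>p. singularity_of_multiplicity n f p (d - 1)) \<or> ST_type n d f"
proof -
  have "\<exists>c. pdiff i g = (\<Sum>j\<le>n. Const (c j) * pdiff j f)" if "i \<le> n" for i
  proof (rule jacobian_ideal_lowest_degree[OF assms(3)])
    show "pdiff i g \<in> jacobian_ideal n f" "homog (d - 1) (pdiff i g)"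
      using that assms(4,6) pdiff_in_jacobian_ideal homog_pdiff by (auto simp: form_in_iff)
  qed
  then obtain A where A: "\<And>i. i \<le> n \<Longrightarrow> pdiff i g = (\<Sum>j\<le>n. Const (A i j) * pdiff j f)"
    by metis
  obtain Q P a \<epsilon> where basis: "linear_change n Q P"
    and QA: "\<forall>i\<le>n. \<forall>j\<le>n. (\<Sum>k\<le>n. Q i k * A k j) = a i * Q i j + \<epsilon> i * Q (Suc i) j"
    and \<epsilon>': "\<forall>i<n. \<epsilon> i \<noteq> 0 \<longrightarrow> a (Suc i) = a i" and \<epsilon>n: "\<epsilon> n = 0"
    using jordan_basis[of n A] by blast
  have \<epsilon>: "\<And>i. i < n \<Longrightarrow> \<epsilon> i \<noteq> 0 \<Longrightarrow> a (Suc i) = a i" "\<epsilon> n = 0"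
    using \<epsilon>' \<epsilon>n by blast+
  interpret linear_change n Q P by (rule basis)
  let ?D = "\<lambda>i. dir_diff n (Q i)"
  have Dg: "?D i g = Const (a i) * ?D i f + Const (\<epsilon> i) * ?D (Suc i) f" if "i \<le> n" for i
  proof -
    have "?D i g = (\<Sum>k\<le>n. \<Sum>j\<le>n. Const (Q i k * A k j) * pdiff j f)"
      by (simp add: dir_diff_def A sum_distrib_left Const_mult mult.assoc)
    also have "\<dots> = (\<Sum>j\<le>n. Const (\<Sum>k\<le>n. Q i k * A k j) * pdiff j f)"
      by (subst sum.swap) (simp add: Const.hom_sum sum_distrib_right)
    also have "\<dots> = Const (a i) * ?D i f + Const (\<epsilon> i) * ?D (Suc i) f"
      using that by (simp add: QA dir_diff_def Const_add Const_mult sum_distrib_left sum.distrib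
          distrib_right mult.assoc)
    finally show ?thesis .
  qed
  show ?thesis
  proof (cases "\<forall>i\<le>n. a i = a 0")
    case False
    have "ST_type n d f"
    proof (rule ST_type_if_split[OF assms(3)])
      show "{i. i \<le> n \<and> a i = a 0} \<subseteq> {..n}" "{i. i \<le> n \<and> a i = a 0} \<noteq> {}"
        "{i. i \<le> n \<and> a i = a 0} \<noteq> {..n}"
        using False by auto
    next
      fix i j assume "i \<in> {i. i \<le> n \<and> a i = a 0}" "j \<in> {..n} - {i. i \<le> n \<and> a i = a 0}"
      then show "?D j (?D i f) = 0"
        using jordan_eigenvalues_differ[of n Q g a f \<epsilon> j i, OF Dg \<epsilon>] by force
    qed
    then show ?thesis ..
  next
    case True
    \<comment> \<open>With a single eigenvalue and no superdiagonal entry \<open>A\<close> would act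
      as a scalar, making \<open>f\<close> and \<open>g\<close> proportional.\<close>
    have "\<exists>i\<le>n. \<epsilon> i \<noteq> 0"
    proof (rule ccontr)
      assume no_\<epsilon>: "\<not> ?thesis"
      have Dg': "?D i g = Const (a 0) * ?D i f" if "i \<le> n" for i
      proof -
        have "a i = a 0" "\<epsilon> i = 0"
          using True no_\<epsilon> that by blast+
        then show ?thesis
          by (simp add: Dg[OF that])
      qed
      have "pdiff j g = Const (a 0) * pdiff j f" if "j \<le> n" for j
      proof -
        \<comment> \<open>The dual basis \<open>P\<close> expresses the ordinary partial derivatives
          through those along the basis.\<close>
        have part: "pdiff j u = (\<Sum>i\<le>n. Const (P j i) * ?D i u)" for u
        proof -
          have "(\<Sum>i\<le>n. Const (P j i) * ?D i u) = (\<Sum>i\<le>n. \<Sum>k\<le>n. Const (P j i * Q i k) * pdiff k u)"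
            by (simp add: dir_diff_def sum_distrib_left Const_mult mult.assoc)
          also have "\<dots> = (\<Sum>k\<le>n. Const (\<Sum>i\<le>n. P j i * Q i k) * pdiff k u)"
            by (subst sum.swap) (simp add: Const.hom_sum sum_distrib_right)
          also have "\<dots> = (\<Sum>k\<le>n. if k = j then pdiff k u else 0)"
            using that by (intro sum.cong) (auto simp: PQ)
          finally show ?thesis
            using that by simp
        qed
        show ?thesis
          unfolding part[of g] part[of f]
          by (simp add: Dg' sum_distrib_left mult.left_commute)
      qed
      then show False
        using proportional_if_partials_proportional[OF assms(3,4)] assms(2,5) by auto
    qed
    \<comment> \<open>Maximality makes \<open>Suc i\<close> the last index of a Jordan block of size
      at least 2; it plays the role of \<open>k\<close>.\<close>
    define i where "i = Max {i. i \<le> n \<and> \<epsilon> i \<noteq> 0}"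
    have "i \<in> {i. i \<le> n \<and> \<epsilon> i \<noteq> 0}"
      unfolding i_def using \<open>\<exists>i\<le>n. \<epsilon> i \<noteq> 0\<close> by (intro Max_in) auto
    then have i: "i < n" "\<epsilon> i \<noteq> 0"
      using \<epsilon>(2) by (auto simp: order_less_le)
    have "\<epsilon> (Suc i) = 0"
    proof (rule ccontr)
      assume "\<epsilon> (Suc i) \<noteq> 0"
      then have "Suc i \<le> i"
        unfolding i_def using i by (intro Max_ge) (auto simp: i_def)
      then show False by simp
    qed
    moreover have "a i = a (Suc i)"
      using \<epsilon>(1) i by simp
    \<comment> \<open>In the symmetry relation for \<open>i\<close> and \<open>Suc i\<close> the
      left side vanishes by equality of the eigenvalues and the first term on the right by
      \<open>\<epsilon> (Suc i) = 0\<close>.\<close>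
    ultimately have "Const (\<epsilon> i) * ?D (Suc i) (?D (Suc i) f) = 0"
      using jordan_second_dir_diff[of n Q g a f \<epsilon> i "Suc i", OF Dg] i by simp
    then have second: "?D (Suc i) (?D (Suc i) f) = 0"
      using i by simp
    have k: "Suc i \<le> n"
      using i by simp
    show ?thesis
    proof (cases "?D (Suc i) f = 0")
      case True
      \<comment> \<open>The cone case: \<open>f\<close> does not involve the coordinate of
        \<open>Q (Suc i)\<close>, so that index alone is split off.\<close>
      have "ST_type n d f"
      proof (rule ST_type_if_split[OF assms(3), of "{Suc i}"])
        show "{Suc i} \<noteq> {..n}"
          by (metis atMost_iff le0 nat.distinct(1) singletonD)
        show "dir_diff n (Q j) (dir_diff n (Q l) f) = 0" if "l \<in> {Suc i}" for l j
          using that True by simp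
      qed (use k in auto)
      then show ?thesis ..
    next
      case False
      then show ?thesis
        using singularity_of_multiplicity_if_second_dir_diff_zero[OF assms(3,2) k second] by blast
    qed
  qed
qed

end
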